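(* Let $r\ge 1$. Let $X$ and $Y$ be connected $C^r$-manifolds of equal dimensions, with $X$ compact. Let $f\colon X\to Y$ be a $C^r$-mapping whose differential $\mathrm{d}f$ is nondegenerate on $X$ (that is, $\operatorname{rank}(\mathrm{d}f)=\dim X$ at every point of $X$), and such that $f(\partial X)\subseteq\partial Y$. Suppose that $X$ and $Y$ have nonempty boundaries with the same number of connected components, and that at least one of the connected components of $\partial Y$ is simply connected. Then $f$ is a $C^r$-diffeomorphism of $X$ onto $Y$.
   Context: An $n$-dimensional topological manifold is a Hausdorff space having a countable cover by open sets each homeomorphic either to $\mathbb{R}^n$ or to $\mathbb{R}^n_+=\{(x_1,\ldots,x_n): x_i\in\mathbb{R},\ x_1\ge 0\}$; its boundary $\partial X$ is the set of points having no neighborhood homeomorphic to $\mathbb{R}^n$. A chart is a homeomorphism of an open domain $U\subset X$ to $\mathbb{R}^n$ or $\mathbb{R}^n_+$; a $C^r$-structure is a cover of $X$ by charts whose transition maps and their inverses are pairwise $C^r$-smooth, two structures being equivalent if their union is also a $C^r$-structure. A $C^r$-manifold is a topological manifold with an equivalence class of $C^r$-structures. A $C^r$-mapping is a continuous mapping that is $C^r$-smooth in charts. A $C^r$-diffeomorphism is a bijective $C^r$-mapping whose inverse is also a $C^r$-mapping. *)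

theory Defs
  imports "HOL-Analysis.Analysis" "HOL-Library.Extended_Nat" "HOL-Library.Equipollence"
begin

section \<open>Functions of class $C^r$\<close>

text \<open>Iterated differentiability on an open set: all iterated directional derivatives up to
  order \<open>n\<close> exist and the last ones are continuous.  Quantifying over directions keeps
  the type of the function fixed along the recursion.\<close>

fun times_continuously_differentiable_on ::
  "nat \<Rightarrow> ('a::real_normed_vector \<Rightarrow> 'b::real_normed_vector) \<Rightarrow> 'a set \<Rightarrow> bool" where
  "times_continuously_differentiable_on 0 f S \<longleftrightarrow> continuous_on S f"
| "times_continuously_differentiable_on (Suc n) f S \<longleftrightarrow>
     (\<forall>x\<in>S. f differentiable (at x)) \<and>
     (\<forall>v. times_continuously_differentiable_on n (\<lambda>x. frechet_derivative f (at x) v) S)"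

text \<open>On a set that need not be open (such as an open subset of a half-space), a function is
  $C^r$ if it extends near every point to a $C^r$ function on an open subset of the
  surrounding space.  The order \<open>r\<close> may be \<open>\<infinity>\<close>.\<close>

definition Cr_on ::
  "enat \<Rightarrow> ('a::real_normed_vector \<Rightarrow> 'b::real_normed_vector) \<Rightarrow> 'a set \<Rightarrow> bool" where
  "Cr_on r f A \<longleftrightarrow>
     (\<forall>x\<in>A. \<exists>W g. open W \<and> x \<in> W \<and>
        (\<forall>k. enat k \<le> r \<longrightarrow> times_continuously_differentiable_on k g W) \<and>
        (\<forall>y\<in>A \<inter> W. g y = f y))"


section \<open>Topological manifolds with boundary\<close>

text \<open>The dimension is \<open>CARD('n)\<close>; the order on the index type only serves to single out a
  first coordinate.\<close>

definition half_space :: "(real ^ 'n::{finite,wellorder}) set" where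
  "half_space = {x. 0 \<le> x $ (LEAST i. True)}"

definition topological_manifold :: "'n::{finite,wellorder} itself \<Rightarrow> 'a topology \<Rightarrow> bool" where
  "topological_manifold (_ :: 'n itself) X \<longleftrightarrow>
     Hausdorff_space X \<and>
     (\<exists>\<U>. countable \<U> \<and> \<Union>\<U> = topspace X \<and>
        (\<forall>U\<in>\<U>. openin X U \<and>
           (subtopology X U homeomorphic_space (euclidean :: (real ^ 'n::_) topology) \<or>
            subtopology X U homeomorphic_space top_of_set (half_space :: (real ^ 'n::_) set))))"

definition manifold_boundary :: "'n::{finite,wellorder} itself \<Rightarrow> 'a topology \<Rightarrow> 'a set" where
  "manifold_boundary (_ :: 'n itself) X =
     {x \<in> topspace X. \<not> (\<exists>U. openin X U \<and> x \<in> U \<and>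
        subtopology X U homeomorphic_space (euclidean :: (real ^ 'n::_) topology))}"


section \<open>$C^r$-structures\<close>

text \<open>A chart is recorded as its domain together with a map, whose values outside the domain
  are irrelevant.\<close>

type_synonym ('a, 'n) chart = "'a set \<times> ('a \<Rightarrow> (real, 'n) vec)"

definition is_chart :: "'a topology \<Rightarrow> ('a, 'n::{finite,wellorder}) chart \<Rightarrow> bool" where
  "is_chart X = (\<lambda>(U, \<phi>). openin X U \<and>
     (homeomorphic_map (subtopology X U) euclidean \<phi> \<or>
      homeomorphic_map (subtopology X U) (top_of_set half_space) \<phi>))"

definition transition_domain ::
  "('a, 'n::{finite,wellorder}) chart \<Rightarrow> ('a, 'n) chart \<Rightarrow> (real ^ 'n::_) set" where
  "transition_domain = (\<lambda>(U, \<phi>) (V, \<psi>). \<phi> ` (U \<inter> V))"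

definition transition_map ::
  "('a, 'n::{finite,wellorder}) chart \<Rightarrow> ('a, 'n) chart \<Rightarrow> real ^ 'n::_ \<Rightarrow> real ^ 'n::_" where
  "transition_map = (\<lambda>(U, \<phi>) (V, \<psi>). \<psi> \<circ> inv_into U \<phi>)"

text \<open>The pair \<open>(c, d)\<close> ranges over both orders, so inverses of transition maps are covered.\<close>

definition Cr_structure ::
  "enat \<Rightarrow> 'a topology \<Rightarrow> ('a, 'n::{finite,wellorder}) chart set \<Rightarrow> bool" where
  "Cr_structure r X \<A> \<longleftrightarrow>
     (\<forall>c\<in>\<A>. is_chart X c) \<and>
     \<Union>(fst ` \<A>) = topspace X \<and>
     (\<forall>c\<in>\<A>. \<forall>d\<in>\<A>. Cr_on r (transition_map c d) (transition_domain c d))"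

definition Cr_equivalence ::
  "enat \<Rightarrow> 'a topology \<Rightarrow>
     (('a, 'n::{finite,wellorder}) chart set \<times> ('a, 'n) chart set) set" where
  "Cr_equivalence r X =
     {(\<A>, \<B>). Cr_structure r X \<A> \<and> Cr_structure r X \<B> \<and> Cr_structure r X (\<A> \<union> \<B>)}"

text \<open>A $C^r$-manifold is a pair of a space \<open>X\<close> and an equivalence class \<open>\<CC>\<close> of
  $C^r$-structures; its charts are the elements of \<open>\<Union>\<CC>\<close>.\<close>

definition Cr_manifold ::
  "enat \<Rightarrow> 'a topology \<Rightarrow> ('a, 'n::{finite,wellorder}) chart set set \<Rightarrow> bool" where
  "Cr_manifold r X \<CC> \<longleftrightarrow>
     topological_manifold TYPE('n) X \<and>
     \<CC> \<in> {\<A>. Cr_structure r X \<A>} // Cr_equivalence r X"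


section \<open>Mappings\<close>

definition local_domain ::
  "('a, 'n::{finite,wellorder}) chart \<Rightarrow> ('b, 'm::{finite,wellorder}) chart \<Rightarrow> ('a \<Rightarrow> 'b) \<Rightarrow>
     (real ^ 'n::_) set" where
  "local_domain = (\<lambda>(U, \<phi>) (V, \<psi>) f. \<phi> ` (U \<inter> f -` V))"

definition local_map ::
  "('a, 'n::{finite,wellorder}) chart \<Rightarrow> ('b, 'm::{finite,wellorder}) chart \<Rightarrow> ('a \<Rightarrow> 'b) \<Rightarrow>
     real ^ 'n::_ \<Rightarrow> real ^ 'm::_" where
  "local_map = (\<lambda>(U, \<phi>) (V, \<psi>) f. \<psi> \<circ> f \<circ> inv_into U \<phi>)"

definition Cr_mapping ::
  "enat \<Rightarrow> 'a topology \<Rightarrow> ('a, 'n::{finite,wellorder}) chart set set \<Rightarrow>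
     'b topology \<Rightarrow> ('b, 'm::{finite,wellorder}) chart set set \<Rightarrow> ('a \<Rightarrow> 'b) \<Rightarrow> bool" where
  "Cr_mapping r X \<CC> Y \<DD> f \<longleftrightarrow>
     continuous_map X Y f \<and>
     (\<forall>c\<in>\<Union>\<CC>. \<forall>d\<in>\<Union>\<DD>. Cr_on r (local_map c d f) (local_domain c d f))"

definition Cr_diffeomorphism ::
  "enat \<Rightarrow> 'a topology \<Rightarrow> ('a, 'n::{finite,wellorder}) chart set set \<Rightarrow>
     'b topology \<Rightarrow> ('b, 'm::{finite,wellorder}) chart set set \<Rightarrow> ('a \<Rightarrow> 'b) \<Rightarrow> bool" where
  "Cr_diffeomorphism r X \<CC> Y \<DD> f \<longleftrightarrow>
     bij_betw f (topspace X) (topspace Y) \<and>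
     Cr_mapping r X \<CC> Y \<DD> f \<and>
     Cr_mapping r Y \<DD> X \<CC> (inv_into (topspace X) f)"

text \<open>The differential of \<open>f\<close> at \<open>x\<close>, read in charts.  The derivative within the local domain
  is unique because that domain is open in the whole space or in the half-space; it is the
  one-sided derivative at boundary points.\<close>

definition has_differential_rank ::
  "('a, 'n::{finite,wellorder}) chart set set \<Rightarrow> ('b, 'm::{finite,wellorder}) chart set set \<Rightarrow>
     ('a \<Rightarrow> 'b) \<Rightarrow> 'a \<Rightarrow> nat \<Rightarrow> bool" where
  "has_differential_rank \<CC> \<DD> f x k \<longleftrightarrow>
     (\<forall>c\<in>\<Union>\<CC>. \<forall>d\<in>\<Union>\<DD>. x \<in> fst c \<and> f x \<in> fst d \<longrightarrow>
        (\<exists>D. (local_map c d f has_derivative D) (at (snd c x) within local_domain c d f) \<and>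
             rank (matrix D) = k))"

definition nondegenerate_differential ::
  "'a topology \<Rightarrow> ('a, 'n::{finite,wellorder}) chart set set \<Rightarrow>
     ('b, 'm::{finite,wellorder}) chart set set \<Rightarrow> ('a \<Rightarrow> 'b) \<Rightarrow> bool" where
  "nondegenerate_differential X \<CC> \<DD> f \<longleftrightarrow>
     (\<forall>x\<in>topspace X. has_differential_rank \<CC> \<DD> f x CARD('n))"


section \<open>Simply connected spaces\<close>

text \<open>The library's notion of a simply connected set, for abstract topologies.  Any two loops,
  in particular any two constant ones, are freely homotopic, so path-connectedness is
  included.\<close>

definition simply_connected_space :: "'a topology \<Rightarrow> bool" where
  "simply_connected_space X \<longleftrightarrow>
     (\<forall>p q. pathin X p \<and> p 1 = p 0 \<and> pathin X q \<and> q 1 = q 0 \<longrightarrow>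
        homotopic_with (\<lambda>h. h 1 = h 0) (top_of_set {0..1}) X p q)"

lemma simply_connected_space_top_of_set:
  "simply_connected_space (top_of_set S) \<longleftrightarrow> simply_connected S"
  unfolding simply_connected_space_def simply_connected_def homotopic_loops_def pathfinish_def
    pathstart_def path_image_def path_def pathin_def continuous_map_subtopology_eu
  by (auto simp: image_subset_iff_funcset)

end

theory Submission
  imports Defs
begin

text \<open>Near every point of \<open>X\<close> the map is a local homeomorphism onto an open set of \<open>Y\<close>.  In charts it
extends to a $C^r$ map \<open>g\<close> of an open set of $\mathbb{R}^n$ with invertible derivative, so \<open>g\<close> has a
local $C^r$ inverse (\<open>Ck_inverse_function_theorem\<close>).  An interior point cannot go to the boundary,
because \<open>g\<close> maps a full neighbourhood of it onto an open set, which would stick out of the half-space.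
At a boundary point \<open>g\<close> takes the bounding hyperplane to the bounding hyperplane and the open
half-space into the open half-space, and then it takes half-balls onto neighbourhoods in the half-space
(\<open>local_homeomorphism_of_models_open\<close>).  Hence \<open>f\<close> is open and locally injective, and the preimage of
\<open>\<partial>Y\<close> is exactly \<open>\<partial>X\<close>.

As \<open>X\<close> is compact, the image of \<open>f\<close> is open and closed in the connected space \<open>Y\<close>, so \<open>f\<close> is a
finite covering of \<open>Y\<close>, and it restricts to a covering
of \<open>\<partial>Y\<close> by \<open>\<partial>X\<close>.  This restriction maps components of \<open>\<partial>X\<close> onto components of \<open>\<partial>Y\<close>, and every
component of \<open>\<partial>Y\<close> is hit.  There are finitely many components, and equally many on both sides, so
distinct components of \<open>\<partial>X\<close> have distinct images, and the preimage of a component of \<open>\<partial>Y\<close> is a single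
component (\<open>component_preimage_is_component\<close>).  Over a simply connected component of \<open>\<partial>Y\<close> this is a
path-connected covering, hence injective (\<open>inj_on_if_simply_connected_base\<close>).  So some point of \<open>Y\<close>
has exactly one preimage.  The set of such points is open and closed in \<open>Y\<close>, therefore \<open>f\<close> is
bijective (\<open>bij_betw_if_unique_preimage\<close>), and the local $C^r$ inverses show that its inverse is a
$C^r$-mapping (\<open>Cr_mapping_inverse\<close>).\<close>

section \<open>Calculus of $C^k$ functions\<close>

abbreviation Ck_on ::
  "nat \<Rightarrow> ('a::real_normed_vector \<Rightarrow> 'b::real_normed_vector) \<Rightarrow> 'a set \<Rightarrow> bool" where
  "Ck_on \<equiv> times_continuously_differentiable_on"

lemma Ck_on_cong:
  assumes "open S" "\<And>x. x \<in> S \<Longrightarrow> f x = g x" "Ck_on k f S"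
  shows "Ck_on k g S"
  using assms(2,3)
proof (induction k arbitrary: f g)
  case 0
  then show ?case using continuous_on_cong[OF refl 0(1), of S] by simp
next
  case (Suc k)
  have f: "f differentiable (at x)" if "x \<in> S" for x
    using Suc.prems(2) that by simp
  have "g differentiable (at x)" if "x \<in> S" for x
    using has_derivative_transform_within_open[of f _ x UNIV S g] \<open>open S\<close> that Suc.prems(1) f[OF that]
    unfolding differentiable_def by blast
  moreover have "frechet_derivative f (at x) v = frechet_derivative g (at x) v" if "x \<in> S" for x v
    using frechet_derivative_transform_within_open[OF f[OF that] \<open>open S\<close> that Suc.prems(1)] by simp
  then have "Ck_on k (\<lambda>x. frechet_derivative g (at x) v) S" for v
    using Suc.IH[of "\<lambda>x. frechet_derivative f (at x) v"] Suc.prems(2) by simp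
  ultimately show ?case by simp
qed

text \<open>The recursion in the definition of $C^k$ is tied to the chosen derivative operator.  The next two
lemmas allow any explicit formula for the derivative in its place, so that
most closure properties below follow by induction on \<open>k\<close> from the corresponding differentiation rule.\<close>

lemma Ck_on_SucI:
  assumes "open S" "\<And>x. x \<in> S \<Longrightarrow> (f has_derivative F x) (at x)"
    and "\<And>v. Ck_on k (\<lambda>x. F x v) S"
  shows "Ck_on (Suc k) f S"
proof -
  have "Ck_on k (\<lambda>x. frechet_derivative f (at x) v) S" for v
  proof (rule Ck_on_cong[OF \<open>open S\<close> _ assms(3)])
    show "F x v = frechet_derivative f (at x) v" if "x \<in> S" for x
      using frechet_derivative_at[OF assms(2)[OF that]] by simp
  qed
  moreover have "f differentiable (at x)" if "x \<in> S" for x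
    using assms(2)[OF that] unfolding differentiable_def by blast
  ultimately show ?thesis
    by simp
qed

lemma Ck_on_SucE:
  assumes "Ck_on (Suc k) f S"
  obtains F where "\<And>x. x \<in> S \<Longrightarrow> (f has_derivative F x) (at x)" "\<And>v. Ck_on k (\<lambda>x. F x v) S"
proof (rule that[of "\<lambda>x. frechet_derivative f (at x)"])
  show "(f has_derivative frechet_derivative f (at x)) (at x)" if "x \<in> S" for x
    using assms that frechet_derivative_works[of f "at x"] by simp
  show "Ck_on k (\<lambda>x. frechet_derivative f (at x) v) S" for v
    using assms by simp
qed

lemma Ck_on_SucD:
  assumes "Ck_on (Suc k) f S"
  shows "Ck_on k f S"
  using assms
proof (induction k arbitrary: f)
  case 0
  then show ?case
    by (auto intro!: continuous_at_imp_continuous_on differentiable_imp_continuous_within)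
next
  case (Suc k)
  have "Ck_on k (\<lambda>x. frechet_derivative f (at x) v) S" for v
    using Suc.IH[of "\<lambda>x. frechet_derivative f (at x) v"] Suc.prems by simp
  then show ?case using Suc.prems by simp
qed

lemma Ck_on_subset:
  assumes "Ck_on k f S" "T \<subseteq> S"
  shows "Ck_on k f T"
  using assms
proof (induction k arbitrary: f)
  case 0
  then show ?case by (auto intro: continuous_on_subset)
qed auto

lemma Ck_on_const: "open S \<Longrightarrow> Ck_on k (\<lambda>x. c) S"
proof (induction k arbitrary: c)
  case (Suc k)
  show ?case
    by (rule Ck_on_SucI[where F="\<lambda>x h. 0"]) (use Suc in auto)
qed simp

lemma Ck_on_bounded_linear:
  assumes "bounded_linear L" "open S" "Ck_on k f S"
  shows "Ck_on k (\<lambda>x. L (f x)) S"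
  using assms(3)
proof (induction k arbitrary: f)
  case 0
  then show ?case
    using assms(1) bounded_linear.continuous_on by auto
next
  case (Suc k)
  obtain F where F: "\<And>x. x \<in> S \<Longrightarrow> (f has_derivative F x) (at x)" "\<And>v. Ck_on k (\<lambda>x. F x v) S"
    using Ck_on_SucE[OF Suc.prems] by blast
  show ?case
    by (rule Ck_on_SucI[where F="\<lambda>x h. L (F x h)"])
      (use F Suc.IH assms bounded_linear.has_derivative in blast)+
qed

lemma Ck_on_add:
  assumes "open S" "Ck_on k f S" "Ck_on k g S"
  shows "Ck_on k (\<lambda>x. f x + g x) S"
  using assms(2,3)
proof (induction k arbitrary: f g)
  case 0
  then show ?case by (auto intro: continuous_on_add)
next
  case (Suc k)
  obtain F where F: "\<And>x. x \<in> S \<Longrightarrow> (f has_derivative F x) (at x)" "\<And>v. Ck_on k (\<lambda>x. F x v) S"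
    using Ck_on_SucE[OF Suc.prems(1)] by blast
  obtain G where G: "\<And>x. x \<in> S \<Longrightarrow> (g has_derivative G x) (at x)" "\<And>v. Ck_on k (\<lambda>x. G x v) S"
    using Ck_on_SucE[OF Suc.prems(2)] by blast
  show ?case
    by (rule Ck_on_SucI[where F="\<lambda>x h. F x h + G x h", OF \<open>open S\<close>])
      (use F G Suc.IH in \<open>auto intro!: has_derivative_add\<close>)
qed

lemma Ck_on_bounded_bilinear:
  assumes "bounded_bilinear B" "open S" "Ck_on k f S" "Ck_on k g S"
  shows "Ck_on k (\<lambda>x. B (f x) (g x)) S"
  using assms(3,4)
proof (induction k arbitrary: f g)
  case 0
  then show ?case
    using assms(1) bounded_bilinear.continuous_on by auto
next
  case (Suc k)
  obtain F where F: "\<And>x. x \<in> S \<Longrightarrow> (f has_derivative F x) (at x)" "\<And>v. Ck_on k (\<lambda>x. F x v) S"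
    using Ck_on_SucE[OF Suc.prems(1)] by blast
  obtain G where G: "\<And>x. x \<in> S \<Longrightarrow> (g has_derivative G x) (at x)" "\<And>v. Ck_on k (\<lambda>x. G x v) S"
    using Ck_on_SucE[OF Suc.prems(2)] by blast
  show ?case
  proof (rule Ck_on_SucI[OF \<open>open S\<close>])
    show "((\<lambda>x. B (f x) (g x)) has_derivative (\<lambda>h. B (f x) (G x h) + B (F x h) (g x))) (at x)"
      if "x \<in> S" for x
      using bounded_bilinear.FDERIV[OF assms(1)] F(1) G(1) that by blast
    show "Ck_on k (\<lambda>x. B (f x) (G x v) + B (F x v) (g x)) S" for v
      by (intro Ck_on_add[OF \<open>open S\<close>] Suc.IH F(2) G(2) Ck_on_SucD[OF Suc.prems(1)]
          Ck_on_SucD[OF Suc.prems(2)])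
  qed
qed

lemmas Ck_on_scaleR = Ck_on_bounded_bilinear[OF bounded_bilinear_scaleR]
lemmas Ck_on_mult = Ck_on_bounded_bilinear[OF bounded_bilinear_mult]

lemma Ck_on_sum:
  assumes "open S" "\<And>i. i \<in> I \<Longrightarrow> Ck_on k (f i) S"
  shows "Ck_on k (\<lambda>x. \<Sum>i\<in>I. f i x) S"
  using assms(2)
  by (induction I rule: infinite_finite_induct)
    (auto intro!: Ck_on_const Ck_on_add assms(1))

lemma Ck_on_prod:
  fixes f :: "'i \<Rightarrow> 'a::real_normed_vector \<Rightarrow> real"
  assumes "open S" "\<And>i. i \<in> I \<Longrightarrow> Ck_on k (f i) S"
  shows "Ck_on k (\<lambda>x. \<Prod>i\<in>I. f i x) S"
  using assms(2)
  by (induction I rule: infinite_finite_induct)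
    (auto intro!: Ck_on_const Ck_on_mult assms(1))

lemma Ck_on_inverse:
  fixes f :: "'a::real_normed_vector \<Rightarrow> real"
  assumes "open S" "\<And>x. x \<in> S \<Longrightarrow> f x \<noteq> 0" "Ck_on k f S"
  shows "Ck_on k (\<lambda>x. inverse (f x)) S"
  using assms(3)
proof (induction k)
  case 0
  then show ?case using assms(2) by (auto intro: continuous_on_inverse)
next
  case (Suc k)
  obtain F where F: "\<And>x. x \<in> S \<Longrightarrow> (f has_derivative F x) (at x)" "\<And>v. Ck_on k (\<lambda>x. F x v) S"
    using Ck_on_SucE[OF Suc.prems] by blast
  have inv: "Ck_on k (\<lambda>x. inverse (f x)) S"
    using Suc Ck_on_SucD by blast
  show ?case
  proof (rule Ck_on_SucI[OF \<open>open S\<close>])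
    show "((\<lambda>x. inverse (f x)) has_derivative (\<lambda>h. - (inverse (f x) * F x h * inverse (f x)))) (at x)"
      if "x \<in> S" for x
      using Deriv.has_derivative_inverse[OF assms(2) F(1)] that by blast
    show "Ck_on k (\<lambda>x. - (inverse (f x) * F x v * inverse (f x))) S" for v
      using Ck_on_bounded_linear[OF bounded_linear_minus[OF bounded_linear_ident] \<open>open S\<close>]
        Ck_on_mult[OF \<open>open S\<close>] inv F(2) by blast
  qed
qed

text \<open>The chain rule applies the derivative of the outer function to a varying vector, whereas the
definition of $C^k$ controls it only along fixed directions.  Expanding that vector in the standard
basis reduces the first case to the second.\<close>

lemma Ck_on_compose:
  fixes f :: "'b::euclidean_space \<Rightarrow> 'c::real_normed_vector"
  assumes "open S" "open T" "h ` S \<subseteq> T" "Ck_on k f T" "Ck_on k h S"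
  shows "Ck_on k (\<lambda>x. f (h x)) S"
  using assms(4,5)
proof (induction k arbitrary: f)
  case 0
  then show ?case using assms(3) by (auto intro: continuous_on_compose2)
next
  case (Suc k)
  obtain F where F: "\<And>x. x \<in> T \<Longrightarrow> (f has_derivative F x) (at x)" "\<And>v. Ck_on k (\<lambda>x. F x v) T"
    using Ck_on_SucE[OF Suc.prems(1)] by blast
  obtain G where G: "\<And>x. x \<in> S \<Longrightarrow> (h has_derivative G x) (at x)" "\<And>v. Ck_on k (\<lambda>x. G x v) S"
    using Ck_on_SucE[OF Suc.prems(2)] by blast
  have chain: "((\<lambda>x. f (h x)) has_derivative (\<lambda>v. \<Sum>b\<in>Basis. (G x v \<bullet> b) *\<^sub>R F (h x) b)) (at x)"
    if "x \<in> S" for x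
  proof -
    have FL: "(f has_derivative F (h x)) (at (h x))"
      using F(1) assms(3) that by blast
    interpret linear "F (h x)"
      using FL has_derivative_linear by blast
    have "F (h x) (G x v) = (\<Sum>b\<in>Basis. (G x v \<bullet> b) *\<^sub>R F (h x) b)" for v
      using sum[of "\<lambda>b. (G x v \<bullet> b) *\<^sub>R b" Basis]
      by (simp only: euclidean_representation scale)
    then show ?thesis
      using diff_chain_at[OF G(1)[OF that] FL] by (simp add: o_def)
  qed
  show ?case
  proof (rule Ck_on_SucI[OF \<open>open S\<close> chain])
    have "Ck_on k (\<lambda>x. F (h x) b) S" for b
      using Suc.IH[OF F(2) Ck_on_SucD[OF Suc.prems(2)]] .
    then show "Ck_on k (\<lambda>x. \<Sum>b\<in>Basis. (G x v \<bullet> b) *\<^sub>R F (h x) b) S" for v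
      by (intro Ck_on_sum Ck_on_scaleR \<open>open S\<close> Ck_on_bounded_linear[OF bounded_linear_inner_left] G(2))
  qed
qed

lemma Ck_on_vec_componentwise:
  fixes f :: "'a::real_normed_vector \<Rightarrow> real ^ 'n"
  assumes "open S" "\<And>i. Ck_on k (\<lambda>x. f x $ i) S"
  shows "Ck_on k f S"
proof -
  have "Ck_on k (\<lambda>x. \<Sum>i\<in>UNIV. (f x $ i) *\<^sub>R axis i (1::real)) S"
    by (intro Ck_on_sum Ck_on_scaleR Ck_on_const assms)
  moreover have "(\<lambda>x. \<Sum>i\<in>UNIV. (f x $ i) *\<^sub>R axis i (1::real)) = f"
    by (simp add: fun_eq_iff vec_eq_iff axis_def if_distrib cong: if_cong)
  ultimately show ?thesis
    by (simp only:)
qed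

lemma Ck_on_det:
  fixes A :: "'a::real_normed_vector \<Rightarrow> real ^ 'n ^ 'n"
  assumes "open S" "\<And>i j. Ck_on k (\<lambda>x. A x $ i $ j) S"
  shows "Ck_on k (\<lambda>x. det (A x)) S"
  unfolding det_def
  by (intro Ck_on_sum Ck_on_mult Ck_on_prod Ck_on_const assms)

text \<open>By Cramer's rule the solution of a linear system is a rational function of its coefficients.\<close>

lemma Ck_on_inv_matrix:
  fixes A :: "'a::real_normed_vector \<Rightarrow> real ^ 'n ^ 'n"
  assumes "open S" "\<And>i j. Ck_on k (\<lambda>x. A x $ i $ j) S"
    and "\<And>x. x \<in> S \<Longrightarrow> det (A x) \<noteq> 0"
    and "\<And>x. x \<in> S \<Longrightarrow> A x *v w x = v"
  shows "Ck_on k w S"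
proof (rule Ck_on_vec_componentwise[OF \<open>open S\<close>])
  fix l
  have w: "det (\<chi> i j. if j = l then v $ i else A x $ i $ j) * inverse (det (A x)) = w x $ l"
    if "x \<in> S" for x
    using cramer[OF assms(3)[OF that], of "w x" v] assms(4)[OF that] by (simp add: field_simps)
  have "Ck_on k (\<lambda>x. det (\<chi> i j. if j = l then v $ i else A x $ i $ j) * inverse (det (A x))) S"
  proof (intro Ck_on_mult Ck_on_det Ck_on_inverse assms)
    show "Ck_on k (\<lambda>x. (\<chi> i j. if j = l then v $ i else A x $ i $ j) $ i $ j) S" for i j
      by (cases "j = l") (simp_all add: assms Ck_on_const)
  qed auto
  then show "Ck_on k (\<lambda>x. w x $ l) S"
    by (rule Ck_on_cong[OF \<open>open S\<close> w, rotated])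
qed

section \<open>The inverse function theorem for $C^r$ functions\<close>

text \<open>The derivative of an inverse \<open>h\<close> at \<open>y\<close> solves the linear system with matrix \<open>f'(h y)\<close>.  If \<open>f\<close> is
$C^{k+1}$ and \<open>h\<close> is already known to be $C^k$, the coefficients of this system are $C^k$, hence so is
the derivative of \<open>h\<close>, which makes \<open>h\<close> of class $C^{k+1}$.\<close>

lemma Ck_on_inverse_function:
  fixes f h :: "real ^ 'n \<Rightarrow> real ^ 'n"
  assumes "open U" "open V" "h ` V \<subseteq> U" "\<And>y. y \<in> V \<Longrightarrow> f (h y) = y"
    and "Ck_on k f U" "\<And>y. y \<in> V \<Longrightarrow> h differentiable (at y)"
  shows "Ck_on k h V"
  using assms(5)
proof (induction k)
  case 0
  then show ?case
    using assms(6) by (auto intro!: continuous_at_imp_continuous_on differentiable_imp_continuous_within)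
next
  case (Suc k)
  have hk: "Ck_on k h V"
    using Suc Ck_on_SucD by blast
  obtain F where F: "\<And>x. x \<in> U \<Longrightarrow> (f has_derivative F x) (at x)" "\<And>v. Ck_on k (\<lambda>x. F x v) U"
    using Ck_on_SucE[OF Suc.prems] by blast
  define H where "H y = frechet_derivative h (at y)" for y
  have H: "(h has_derivative H y) (at y)" if "y \<in> V" for y
    using assms(6) that frechet_derivative_works H_def by metis
  have FH: "F (h y) (H y v) = v" if "y \<in> V" for y v
  proof -
    \<comment> \<open>Differentiating \<open>f (h y) = y\<close>: the derivative of \<open>h\<close> is the inverse of that of \<open>f\<close>.\<close>
    have "((\<lambda>y. f (h y)) has_derivative (\<lambda>v. F (h y) (H y v))) (at y)"
      using diff_chain_at[OF H[OF that], of f "F (h y)"] F(1) assms(3) that by (auto simp: o_def)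
    then have "((\<lambda>y. y) has_derivative (\<lambda>v. F (h y) (H y v))) (at y)"
      by (rule has_derivative_transform_within_open[OF _ \<open>open V\<close> that]) (simp add: assms(4))
    then have "(\<lambda>v. F (h y) (H y v)) = (\<lambda>v. v)"
      using has_derivative_unique has_derivative_ident by blast
    then show ?thesis by metis
  qed
  have lin: "linear (F (h y))" if "y \<in> V" for y
    using F(1) assms(3) that has_derivative_linear by blast
  have det: "det (matrix (F (h y))) \<noteq> 0" if "y \<in> V" for y
  proof -
    have "surj (F (h y))"
      using FH[OF that] by (metis surjI)
    then show ?thesis
      using lin[OF that] det_nz_iff_inj[OF lin[OF that]] linear_surjective_imp_injective by blast
  qed
  show ?case
  proof (rule Ck_on_SucI[OF \<open>open V\<close> H])
    show "Ck_on k (\<lambda>y. H y v) V" for v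
    proof (rule Ck_on_inv_matrix[OF \<open>open V\<close> _ det])
      show "matrix (F (h y)) *v H y v = v" if "y \<in> V" for y
        using FH[OF that] lin[OF that] by simp
      have "Ck_on k (\<lambda>y. F (h y) (axis j 1) $ i) V" for i j
        by (rule Ck_on_bounded_linear[OF bounded_linear_vec_nth \<open>open V\<close>
              Ck_on_compose[OF \<open>open V\<close> \<open>open U\<close> assms(3) F(2) hk]])
      then show "Ck_on k (\<lambda>y. matrix (F (h y)) $ i $ j) V" for i j
        by (simp add: matrix_def)
    qed
  qed
qed

text \<open>The neighbourhood produced by the $C^1$ inverse function theorem serves all orders at once, so no
shrinking with the order takes place; this matters for \<open>r = \<infinity>\<close>.\<close>

lemma Ck_inverse_function_theorem:
  fixes g :: "real ^ 'n \<Rightarrow> real ^ 'n" and r :: enat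
  assumes "1 \<le> r" "open W" "p \<in> W" "\<And>k. enat k \<le> r \<Longrightarrow> Ck_on k g W"
    and D: "(g has_derivative D) (at p)" "inj D"
  obtains U V h where "open U" "U \<subseteq> W" "p \<in> U" "open V" "g p \<in> V" "homeomorphism U V g h"
    "\<And>k. enat k \<le> r \<Longrightarrow> Ck_on k h V"
proof -
  have "enat (Suc 0) \<le> r"
    using \<open>1 \<le> r\<close> by (simp add: one_enat_def)
  then obtain F where F: "\<And>x. x \<in> W \<Longrightarrow> (g has_derivative F x) (at x)" "\<And>v. Ck_on 0 (\<lambda>x. F x v) W"
    using Ck_on_SucE[OF assms(4)] by metis
  define F' where "F' x = Blinfun (F x)" for x
  have bl: "bounded_linear (F x)" if "x \<in> W" for x
    using F(1)[OF that] by (rule has_derivative_bounded_linear)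
  have F'[simp]: "blinfun_apply (F' x) = F x" if "x \<in> W" for x
    using bl[OF that] by (simp add: F'_def bounded_linear_Blinfun_apply)
  have cont: "continuous_on W F'"
  proof (intro continuous_at_imp_continuous_on ballI continuous_blinfun_componentwiseI1)
    fix x i assume x: "x \<in> W"
    have "continuous_on W (\<lambda>x. F x i)"
      using F(2) by simp
    then have "continuous_on W (\<lambda>x. blinfun_apply (F' x) i)"
      by (simp cong: continuous_on_cong_simp)
    then show "isCont (\<lambda>x. blinfun_apply (F' x) i) x"
      using x \<open>open W\<close> continuous_on_eq_continuous_at by blast
  qed
  have FD: "F p = D"
    using has_derivative_unique F(1) D(1) \<open>p \<in> W\<close> by blast
  obtain L where L: "linear L" "L \<circ> D = id"
    using linear_injective_left_inverse[OF has_derivative_linear[OF D(1)] D(2)] by blast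
  have inv: "Blinfun L o\<^sub>L F' p = id_blinfun"
  proof (rule blinfun_eqI)
    fix v
    have "L (D v) = v"
      using L(2) by (metis comp_apply id_apply)
    then show "blinfun_apply (Blinfun L o\<^sub>L F' p) v = blinfun_apply id_blinfun v"
      using FD \<open>p \<in> W\<close> L(1) by (simp add: bounded_linear_Blinfun_apply linear_conv_bounded_linear)
  qed
  have der: "(g has_derivative blinfun_apply (F' x)) (at x)" if "x \<in> W" for x
    using F(1) that by simp
  show thesis
  proof (rule inverse_function_theorem[OF \<open>open W\<close> der cont \<open>p \<in> W\<close> inv])
    fix U V h h'
    assume UV: "open U" "U \<subseteq> W" "p \<in> U" "open V" "g p \<in> V" "homeomorphism U V g h"
      and h': "\<And>y. y \<in> V \<Longrightarrow> (h has_derivative h' y) (at y)"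
    have "Ck_on k h V" if "enat k \<le> r" for k
    proof (rule Ck_on_inverse_function[of U])
      show "h ` V \<subseteq> U" "\<And>y. y \<in> V \<Longrightarrow> g (h y) = y"
        using UV(6) by (auto simp: homeomorphism_def)
      show "Ck_on k g U"
        using Ck_on_subset[OF assms(4)[OF that] UV(2)] .
      show "h differentiable (at y)" if "y \<in> V" for y
        using h'[OF that] differentiable_def by blast
    qed (use UV in auto)
    then show thesis
      by (rule that[OF UV])
  qed
qed

section \<open>The model half-space\<close>

text \<open>The two possible images of a chart.  Treating them together avoids a case distinction wherever only
the interior of the model matters: the interior of the whole space is everything, and that of the
half-space omits precisely the bounding hyperplane.\<close>

definition euclidean_model :: "(real ^ 'n::{finite,wellorder}) set \<Rightarrow> bool" where
  "euclidean_model M \<longleftrightarrow> M = UNIV \<or> M = half_space"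

lemma interior_half_space:
  "interior (half_space :: (real ^ 'n::{finite,wellorder}) set) = {x. 0 < x $ (LEAST i. True)}"
  unfolding half_space_def using interior_halfspace_component_ge[of 0 "LEAST i. True"] by simp

lemma closure_interior_half_space:
  "closure (interior (half_space :: (real ^ 'n::{finite,wellorder}) set)) = half_space"
  unfolding interior_half_space
  using closure_halfspace_component_gt[of 0 "LEAST i. True"] by (simp add: half_space_def)

text \<open>From a point of the half-space one can move a little in each positive coordinate direction without
leaving it, and these directions form a basis.  So a one-sided derivative on the boundary is
determined, and it agrees with the derivative of any differentiable extension.\<close>

lemma euclidean_model_has_derivative_unique:
  fixes M :: "(real ^ 'n::{finite,wellorder}) set" and g :: "(real, 'n) vec \<Rightarrow> 'b::real_normed_vector"
  assumes "euclidean_model M" "openin (top_of_set M) A" "p \<in> A"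
    and "(g has_derivative D) (at p within A)" "(g has_derivative D') (at p within A)"
  shows "D = D'"
proof (rule frechet_derivative_unique_within[OF assms(4,5)])
  fix i :: "(real, 'n) vec" and e :: real
  assume i: "i \<in> Basis" and "0 < e"
  obtain T where T: "open T" "A = M \<inter> T"
    using assms(2) openin_open by blast
  have lim: "(\<lambda>d. p + d *\<^sub>R i) \<midarrow>0\<rightarrow> p + 0 *\<^sub>R i"
    by (intro tendsto_intros)
  have "\<forall>\<^sub>F d in at 0. p + d *\<^sub>R i \<in> T"
    using topological_tendstoD[OF lim, of T] T \<open>p \<in> A\<close> by simp
  then obtain d0 where d0: "d0 > 0" "\<And>d. d \<noteq> 0 \<Longrightarrow> dist d 0 < d0 \<Longrightarrow> p + d *\<^sub>R i \<in> T"
    unfolding eventually_at by blast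
  define d where "d = min d0 e / 2"
  have d: "0 < d" "d < d0" "d < e"
    using \<open>0 < e\<close> \<open>d0 > 0\<close> by (auto simp: d_def)
  have "0 \<le> i $ k" for k
    using i by (auto simp: Basis_vec_def axis_def)
  then have "p + d *\<^sub>R i \<in> M"
    using assms(1,3) T(2) d(1) by (auto simp: euclidean_model_def half_space_def)
  then show "\<exists>d. 0 < \<bar>d\<bar> \<and> \<bar>d\<bar> < e \<and> p + d *\<^sub>R i \<in> A"
    using d d0 T(2) by (intro exI[of _ d]) auto
qed

lemma homeomorphism_open_image:
  assumes "homeomorphism P Q g h" "open Q" "open T" "T \<subseteq> P"
  shows "open (g ` T)"
proof -
  have "g ` T = Q \<inter> h -` T"
    using assms(1,4) unfolding homeomorphism_def by (auto simp: image_iff)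
  then show ?thesis
    using assms continuous_open_preimage homeomorphism_cont2 by (metis Int_commute)
qed

text \<open>Near an interior point of \<open>M\<close> this is plain openness of \<open>g\<close>.  At a boundary point \<open>p\<close> take a small ball
around \<open>g p\<close>.  Its part \<open>I\<close> inside the open half-space is convex, so \<open>h ` I\<close> is connected, and it avoids
the hyperplane, whose points are mapped into the hyperplane.  It also contains points of the open
half-space, since these accumulate at \<open>p\<close>; hence it lies on that side.  By continuity \<open>h\<close> takes the
whole half-ball into the closed half-space.\<close>

lemma local_homeomorphism_of_models_open:
  fixes g h :: "real ^ 'n::{finite,wellorder} \<Rightarrow> real ^ 'n::_"
  assumes M: "euclidean_model M" "euclidean_model N"
    and hom: "homeomorphism P Q g h" "open P" "open Q"
    and A: "openin (top_of_set M) A" "A \<subseteq> P" "g ` A \<subseteq> N"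
    and bd: "\<And>p. p \<in> A \<Longrightarrow> p \<in> interior M \<longleftrightarrow> g p \<in> interior N"
  shows "openin (top_of_set N) (g ` A)"
  unfolding openin_contains_ball
proof (intro conjI ballI A(3))
  fix q assume "q \<in> g ` A"
  then obtain p where p: "p \<in> A" "q = g p" by blast
  obtain T where T: "open T" "A = M \<inter> T"
    using A(1) openin_open by blast
  have gh: "\<And>x. x \<in> P \<Longrightarrow> h (g x) = x" "\<And>y. y \<in> Q \<Longrightarrow> g (h y) = y"
    using hom(1) by (auto simp: homeomorphism_def)
  show "\<exists>e>0. ball q e \<inter> N \<subseteq> g ` A"
  proof (cases "p \<in> interior M")
    case True
    have sub: "interior M \<inter> T \<subseteq> A"
      using T interior_subset by blast
    then have "open (g ` (interior M \<inter> T))"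
      by (intro homeomorphism_open_image[OF hom(1,3)]) (use T A in auto)
    moreover have "q \<in> g ` (interior M \<inter> T)"
      using True p T by auto
    ultimately obtain e where "e > 0" "ball q e \<subseteq> g ` (interior M \<inter> T)"
      using open_contains_ball by blast
    then show ?thesis
      using sub by blast
  next
    case False
    then have "g p \<notin> interior N"
      using bd p by blast
    then have MN: "M = half_space" "N = half_space"
      using M False by (auto simp: euclidean_model_def)
    let ?k = "LEAST i::'n. True"
    have "open (g ` (P \<inter> T))"
      by (intro homeomorphism_open_image[OF hom(1,3)]) (use T hom in auto)
    moreover have "q \<in> g ` (P \<inter> T)"
      using p T A by auto
    ultimately obtain e where e: "e > 0" "ball q e \<subseteq> g ` (P \<inter> T)"
      using open_contains_ball by blast
    define B where "B = ball q e"
    have BQ: "B \<subseteq> Q" and hB: "h ` B \<subseteq> P \<inter> T"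
      using e(2) hom(1) gh unfolding B_def homeomorphism_def by auto
    have hopen: "open (h ` B)"
      using homeomorphism_open_image[OF homeomorphism_symD[OF hom(1)] hom(2) _ BQ] by (simp add: B_def)
    define I where "I = B \<inter> interior N"
    have conth: "continuous_on B h"
      using hom(1) BQ homeomorphism_cont2 continuous_on_subset by blast
    have "convex {x :: (real, 'n) vec. 0 < x $ ?k}"
      using convex_halfspace_gt[of 0 "axis ?k 1 :: (real, 'n) vec"] by (simp add: inner_axis' )
    then have "convex I"
      unfolding I_def B_def MN interior_half_space by (intro convex_Int) auto
    then have conn: "connected (h ` I)"
      by (intro connected_continuous_image convex_connected continuous_on_subset[OF conth])
        (auto simp: I_def)
    \<comment> \<open>A point of \<open>h ` I\<close> on the hyperplane would lie in \<open>A\<close> and be mapped to the hyperplane.\<close>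
    have nz: "z $ ?k \<noteq> 0" if z: "z \<in> h ` I" for z
    proof
      assume "z $ ?k = 0"
      then have "z \<in> A"
        using z hB T MN by (auto simp: I_def half_space_def)
      moreover have "z \<notin> interior M"
        using \<open>z $ ?k = 0\<close> MN by (simp add: interior_half_space)
      moreover have "g z \<in> interior N"
        using z gh(2) BQ by (auto simp: I_def)
      ultimately show False
        using bd by blast
    qed
    have "p \<in> h ` B"
      using p A(2) gh(1) e(1) by (intro image_eqI[of _ _ q]) (auto simp: B_def)
    moreover have "p \<in> closure (interior M)"
      using p T MN closure_interior_half_space by auto
    ultimately have "h ` B \<inter> interior M \<noteq> {}"
      using hopen open_Int_closure_eq_empty[OF hopen, of "interior M"] by auto
    then obtain b where b: "b \<in> B" "h b \<in> interior M"
      by blast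
    define z where "z = h b"
    have "z \<in> A"
      using b hB T interior_subset unfolding z_def by blast
    then have "g z \<in> interior N"
      using bd b(2) unfolding z_def by blast
    then have zI: "z \<in> h ` I"
      using b(1) gh(2) BQ by (auto simp: I_def z_def)
    \<comment> \<open>The connected set \<open>h ` I\<close> would otherwise cross the hyperplane on its way to \<open>z\<close>.\<close>
    have pos: "0 < z' $ ?k" if "z' \<in> h ` I" for z'
    proof (rule ccontr)
      assume "\<not> 0 < z' $ ?k"
      then have "z' $ ?k \<le> 0" by simp
      moreover have "0 \<le> z $ ?k"
        using b(2) MN by (simp add: z_def interior_half_space less_imp_le)
      ultimately show False
        using connected_ivt_component_cart[OF conn that zI, of ?k 0] nz by blast
    qed
    have "h y \<in> half_space" if y: "y \<in> B" "y \<in> N" for y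
    proof (rule ccontr)
      assume "h y \<notin> half_space"
      have cl: "closed (half_space :: ((real, 'n) vec) set)"
        using closure_interior_half_space closed_closure by metis
      have "open (B \<inter> h -` (- half_space))"
        using continuous_open_preimage[OF conth, of "- half_space"] cl by (auto simp: B_def)
      moreover have "y \<in> B \<inter> h -` (- half_space)"
        using y \<open>h y \<notin> half_space\<close> by simp
      moreover have "y \<in> closure (interior N)"
        using y MN closure_interior_half_space by auto
      ultimately have "(B \<inter> h -` (- half_space)) \<inter> interior N \<noteq> {}"
        using open_Int_closure_eq_empty by blast
      then obtain w where "w \<in> I" "h w \<notin> half_space"
        by (auto simp: I_def)
      then show False
        using pos[of "h w"] by (auto simp: half_space_def)
    qed
    then have "h y \<in> A \<and> g (h y) = y" if "y \<in> ball q e \<inter> N" for y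
      using that hB gh(2) BQ T MN by (auto simp: B_def)
    then have "ball q e \<inter> N \<subseteq> g ` A"
      by (metis imageI subsetI)
    then show ?thesis
      using e(1) by blast
  qed
qed

section \<open>Charts and the boundary\<close>

text \<open>The image is made explicit because the position of a point in it decides whether the point belongs
to the boundary.\<close>

definition model_chart ::
  "(real ^ 'n::{finite,wellorder}) set \<Rightarrow> 'a topology \<Rightarrow> 'a set \<Rightarrow> ('a \<Rightarrow> (real, 'n) vec) \<Rightarrow> bool" where
  "model_chart M X U \<phi> \<longleftrightarrow>
     euclidean_model M \<and> openin X U \<and> homeomorphic_map (subtopology X U) (top_of_set M) \<phi>"

lemma is_chart_imp_model_chart:
  assumes "is_chart X (U, \<phi>)"
  obtains M where "model_chart M X U \<phi>"
  using assms that unfolding is_chart_def model_chart_def euclidean_model_def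
  by (metis (no_types, lifting) case_prod_conv subtopology_UNIV)

lemma
  assumes "model_chart M X U \<phi>"
  shows model_chart_subset: "U \<subseteq> topspace X"
    and model_chart_inj: "inj_on \<phi> U"
    and model_chart_image: "\<phi> ` U = M"
    and model_chart_openin_image: "\<And>T. openin X T \<Longrightarrow> T \<subseteq> U \<Longrightarrow> openin (top_of_set M) (\<phi> ` T)"
    and model_chart_openin_preimage: "\<And>B. openin (top_of_set M) B \<Longrightarrow> openin X {u \<in> U. \<phi> u \<in> B}"
proof -
  have U: "openin X U" and hom: "homeomorphic_map (subtopology X U) (top_of_set M) \<phi>"
    using assms by (auto simp: model_chart_def)
  show sub: "U \<subseteq> topspace X"
    using U openin_subset by blast
  then have [simp]: "topspace X \<inter> U = U" by blast
  show "inj_on \<phi> U" "\<phi> ` U = M"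
    using homeomorphic_imp_injective_map[OF hom] homeomorphic_imp_surjective_map[OF hom] by auto
  show "openin (top_of_set M) (\<phi> ` T)" if "openin X T" "T \<subseteq> U" for T
    using homeomorphic_imp_open_map[OF hom] that U by (auto simp: open_map_def openin_open_subtopology)
  show "openin X {u \<in> U. \<phi> u \<in> B}" if "openin (top_of_set M) B" for B
    using openin_continuous_map_preimage[OF homeomorphic_imp_continuous_map[OF hom] that] U
    by (auto simp: openin_open_subtopology)
qed

text \<open>If a chart takes \<open>u\<close> to an interior point of its model, then the preimage of a small ball is a
Euclidean neighbourhood.  Conversely, a Euclidean neighbourhood of \<open>u\<close> read in the chart is open in
the surrounding space by invariance of domain, so it puts the image of \<open>u\<close> in the interior of the
model.\<close>

lemma model_chart_boundary_iff:
  fixes M :: "(real ^ 'n::{finite,wellorder}) set"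
  assumes chart: "model_chart M X U \<phi>" and "u \<in> U"
  shows "u \<in> manifold_boundary TYPE('n) X \<longleftrightarrow> \<phi> u \<notin> interior M"
proof
  have hom: "homeomorphic_map (subtopology X U) (top_of_set M) \<phi>"
    using chart by (simp add: model_chart_def)
  note sub = model_chart_subset[OF chart] and inj = model_chart_inj[OF chart]
    and im = model_chart_image[OF chart]
  show "\<phi> u \<notin> interior M" if bd: "u \<in> manifold_boundary TYPE('n) X"
  proof
    assume "\<phi> u \<in> interior M"
    then obtain e where e: "e > 0" "ball (\<phi> u) e \<subseteq> M"
      using mem_interior by blast
    define N where "N = {v \<in> U. \<phi> v \<in> ball (\<phi> u) e}"
    have "openin (top_of_set M) (ball (\<phi> u) e)"
      using e(2) by (simp add: open_subset)
    then have "openin X N" "u \<in> N"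
      using model_chart_openin_preimage[OF chart, of "ball (\<phi> u) e"] \<open>u \<in> U\<close> e(1)
      unfolding N_def by simp_all
    have "\<phi> ` (topspace (subtopology X U) \<inter> N) = topspace (top_of_set M) \<inter> ball (\<phi> u) e"
      using sub im e(2) by (auto simp: N_def)
    from homeomorphic_map_subtopologies[OF hom this]
    have "homeomorphic_map (subtopology X N) (top_of_set (ball (\<phi> u) e)) \<phi>"
      using e(2) by (simp add: subtopology_subtopology N_def Int_absorb1 Int_absorb2 Collect_conj_eq Int_assoc[symmetric])
    then have "subtopology X N homeomorphic_space top_of_set (ball (\<phi> u) e)"
      by (rule homeomorphic_map_imp_homeomorphic_space)
    moreover have "top_of_set (ball (\<phi> u) e) homeomorphic_space (euclidean :: (real, 'n) vec topology)"
    proof -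
      obtain a b where ab: "homeomorphism (ball (\<phi> u) e) (UNIV :: (real, 'n) vec set) a b"
        using homeomorphic_ball_UNIV[OF e(1), of "\<phi> u"] by (auto simp: homeomorphic_def)
      then have "b y \<in> ball (\<phi> u) e" for y
        unfolding homeomorphism_def by blast
      then have "homeomorphic_maps (top_of_set (ball (\<phi> u) e)) euclidean a b"
        using ab by (auto simp: homeomorphic_maps_def homeomorphism_def continuous_map_in_subtopology)
      then show ?thesis
        unfolding homeomorphic_space_def by blast
    qed
    ultimately have "subtopology X N homeomorphic_space (euclidean :: (real, 'n) vec topology)"
      using homeomorphic_space_trans by blast
    then show False
      using bd \<open>openin X N\<close> \<open>u \<in> N\<close> unfolding manifold_boundary_def by blast
  qed
  show "u \<in> manifold_boundary TYPE('n) X" if "\<phi> u \<notin> interior M"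
  proof (rule ccontr)
    assume "u \<notin> manifold_boundary TYPE('n) X"
    then obtain N where N: "openin X N" "u \<in> N"
      "subtopology X N homeomorphic_space (euclidean :: (real, 'n) vec topology)"
      using sub \<open>u \<in> U\<close> unfolding manifold_boundary_def by blast
    then obtain \<psi> \<eta> where maps: "homeomorphic_maps (subtopology X N) (euclidean :: (real, 'n) vec topology) \<psi> \<eta>"
      unfolding homeomorphic_space_def by blast
    then have "homeomorphic_map (subtopology X N) (euclidean :: (real, 'n) vec topology) \<psi>"
      using homeomorphic_maps_map by blast
    then have "model_chart UNIV X N \<psi>"
      using N(1) by (simp add: model_chart_def euclidean_model_def)
    from model_chart_openin_image[OF this, of "U \<inter> N"]
    have "open (\<psi> ` (U \<inter> N))"
      using chart N(1) by (auto simp: model_chart_def)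
    moreover have NX: "N \<subseteq> topspace X"
      using N(1) openin_subset by blast
    then have \<eta>: "\<eta> (\<psi> x) = x" if "x \<in> N" for x
      using maps that by (auto simp: homeomorphic_maps_def)
    have "continuous_map (top_of_set (\<psi> ` (U \<inter> N))) (subtopology X U) \<eta>"
    proof -
      have "continuous_map (top_of_set (\<psi> ` (U \<inter> N))) (subtopology X N) \<eta>"
        using maps continuous_map_from_subtopology unfolding homeomorphic_maps_def by blast
      then show ?thesis
        using \<eta> by (auto simp: continuous_map_in_subtopology)
    qed
    from continuous_map_compose[OF this homeomorphic_imp_continuous_map[OF hom]]
    have "continuous_on (\<psi> ` (U \<inter> N)) (\<phi> \<circ> \<eta>)"
      by (simp add: continuous_map_in_subtopology)
    moreover have "inj_on (\<phi> \<circ> \<eta>) (\<psi> ` (U \<inter> N))"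
      using inj \<eta> by (auto simp: inj_on_def)
    ultimately have "open ((\<phi> \<circ> \<eta>) ` \<psi> ` (U \<inter> N))"
      using invariance_of_domain by blast
    moreover have "(\<phi> \<circ> \<eta>) ` \<psi> ` (U \<inter> N) = \<phi> ` (U \<inter> N)"
      using \<eta> by (auto simp: image_image)
    ultimately have "\<phi> u \<in> interior M"
      using im \<open>u \<in> U\<close> N(2) by (intro interiorI[of "\<phi> ` (U \<inter> N)"]) auto
    then show False
      using that by blast
  qed
qed

text \<open>In a half-space chart the boundary is the full bounding hyperplane, which is convex.\<close>

lemma boundary_path_connected_nbhd:
  fixes M :: "(real ^ 'n::{finite,wellorder}) set"
  assumes chart: "model_chart M X U \<phi>" and u: "u \<in> U" "u \<in> manifold_boundary TYPE('n) X"
  shows "path_connectedin X (U \<inter> manifold_boundary TYPE('n) X)"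
proof -
  let ?k = "LEAST i::'n. True"
  have "M = half_space"
    using chart u model_chart_boundary_iff[OF chart u(1)] by (auto simp: model_chart_def euclidean_model_def)
  obtain \<eta> where \<eta>: "homeomorphic_maps (subtopology X U) (top_of_set M) \<phi> \<eta>"
    using chart by (auto simp: model_chart_def homeomorphic_map_maps)
  let ?P = "{x :: (real, 'n) vec. x $ ?k = 0}"
  have bd: "v \<in> manifold_boundary TYPE('n) X \<longleftrightarrow> \<phi> v $ ?k = 0" if "v \<in> U" for v
    using model_chart_boundary_iff[OF chart that] model_chart_image[OF chart] that
    unfolding \<open>M = half_space\<close> interior_half_space by (force simp: half_space_def)
  have "convex ?P"
    using convex_hyperplane[of "axis ?k (1::real)" 0] by (simp add: inner_axis')
  then have "path_connectedin euclidean ?P"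
    by (simp add: convex_imp_path_connected)
  moreover have PM: "?P \<subseteq> M"
    unfolding \<open>M = half_space\<close> by (auto simp: half_space_def)
  ultimately have "path_connectedin (top_of_set M) ?P"
    by (simp add: path_connectedin_subtopology)
  moreover have "continuous_map (top_of_set M) X \<eta>"
    using \<eta> by (auto simp: homeomorphic_maps_def continuous_map_in_subtopology)
  ultimately have "path_connectedin X (\<eta> ` ?P)"
    by (rule path_connectedin_continuous_map_image[rotated])
  moreover have "\<eta> ` ?P = U \<inter> manifold_boundary TYPE('n) X"
  proof (intro subset_antisym subsetI)
    fix v assume "v \<in> \<eta> ` ?P"
    then obtain y where "y \<in> ?P" "v = \<eta> y" by blast
    moreover from this have "y \<in> M"
      using PM by blast
    ultimately have "v \<in> U" "\<phi> v $ ?k = 0"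
      using \<eta> by (auto simp: homeomorphic_maps_def continuous_map_def)
    then show "v \<in> U \<inter> manifold_boundary TYPE('n) X"
      using bd by blast
  next
    fix v assume v: "v \<in> U \<inter> manifold_boundary TYPE('n) X"
    then have "\<eta> (\<phi> v) = v"
      using \<eta> model_chart_subset[OF chart] by (auto simp: homeomorphic_maps_def)
    then show "v \<in> \<eta> ` ?P"
      using bd v by (metis (mono_tags, lifting) IntE image_eqI mem_Collect_eq)
  qed
  ultimately show ?thesis by simp
qed

lemma Cr_manifold_is_chart:
  assumes "Cr_manifold r X \<CC>" "c \<in> \<Union>\<CC>"
  shows "is_chart X c"
proof -
  obtain \<A> where \<A>: "Cr_structure r X \<A>" "\<CC> = Cr_equivalence r X `` {\<A>}"
    using assms(1) unfolding Cr_manifold_def quotient_def by blast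
  then show ?thesis
    using assms(2) by (auto simp: Cr_equivalence_def Cr_structure_def)
qed

lemma Cr_manifold_chart_at:
  assumes "Cr_manifold r X \<CC>" "x \<in> topspace X"
  obtains M U \<phi> where "(U, \<phi>) \<in> \<Union>\<CC>" "model_chart M X U \<phi>" "x \<in> U"
proof -
  obtain \<A> where \<A>: "Cr_structure r X \<A>" "\<CC> = Cr_equivalence r X `` {\<A>}"
    using assms(1) unfolding Cr_manifold_def quotient_def by blast
  then have "\<A> \<in> \<CC>"
    by (simp add: Cr_equivalence_def)
  moreover have "x \<in> \<Union>(fst ` \<A>)"
    using \<A>(1) assms(2) by (simp add: Cr_structure_def)
  then obtain U \<phi> where "(U, \<phi>) \<in> \<A>" "x \<in> U"
    by (metis UN_E prod.collapse)
  ultimately have c: "(U, \<phi>) \<in> \<Union>\<CC>" "x \<in> U"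
    by blast+
  then show ?thesis
    using is_chart_imp_model_chart[OF Cr_manifold_is_chart[OF assms(1) c(1)]] that by metis
qed

lemma closedin_manifold_boundary: "closedin X (manifold_boundary TYPE('n::{finite,wellorder}) X)"
proof -
  let ?B = "manifold_boundary TYPE('n) X"
  have "openin X (topspace X - ?B)"
  proof (subst openin_subopen, intro ballI)
    fix x assume "x \<in> topspace X - ?B"
    then obtain U where U: "openin X U" "x \<in> U"
      "subtopology X U homeomorphic_space (euclidean :: (real, 'n) vec topology)"
      unfolding manifold_boundary_def by blast
    then have "U \<subseteq> topspace X - ?B"
      using openin_subset[OF U(1)] unfolding manifold_boundary_def by blast
    then show "\<exists>T. openin X T \<and> x \<in> T \<and> T \<subseteq> topspace X - ?B"
      using U by blast
  qed
  moreover have "?B \<subseteq> topspace X"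
    by (auto simp: manifold_boundary_def)
  ultimately show ?thesis
    by (simp add: closedin_def)
qed

lemma manifold_boundary_path_connected_nbhds:
  fixes X :: "'a topology" and \<CC> :: "('a, 'n::{finite,wellorder}) chart set set"
  defines "B \<equiv> subtopology X (manifold_boundary TYPE('n) X)"
  assumes "Cr_manifold r X \<CC>" "x \<in> topspace B"
  shows "\<exists>N. openin B N \<and> x \<in> N \<and> path_connectedin B N"
proof -
  let ?B = "manifold_boundary TYPE('n) X"
  have x: "x \<in> topspace X" "x \<in> ?B"
    using assms(3) by (auto simp: B_def)
  obtain M :: "(real, 'n) vec set" and U \<phi> where U: "model_chart M X U \<phi>" "x \<in> U"
    using Cr_manifold_chart_at[OF assms(2) x(1)] by metis
  have "path_connectedin B (U \<inter> ?B)"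
    using boundary_path_connected_nbhd[OF U x(2)] by (simp add: B_def path_connectedin_subtopology)
  moreover have "openin B (U \<inter> ?B)"
    using U(1) by (auto simp: B_def model_chart_def intro: openin_subtopology_Int)
  ultimately show ?thesis
    using U x by blast
qed

section \<open>Connected components\<close>

text \<open>For locally path-connected spaces the connected components are open and coincide with the path
components; one path-connected open neighbourhood of each point is enough for that.\<close>

lemma
  assumes nbhd: "\<And>x. x \<in> topspace B \<Longrightarrow> \<exists>N. openin B N \<and> x \<in> N \<and> path_connectedin B N"
    and C: "C \<in> connected_components_of B"
  shows openin_component_if_path_connected_nbhds: "openin B C"
    and path_connectedin_component_if_path_connected_nbhds: "path_connectedin B C"
proof -
  have CB: "C \<subseteq> topspace B"
    using C connected_components_of_subset by blast
  show "openin B C"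
  proof (subst openin_subopen, intro ballI)
    fix x assume "x \<in> C"
    then obtain N where N: "openin B N" "x \<in> N" "path_connectedin B N"
      using nbhd CB by blast
    then have "N \<subseteq> C"
      using connected_components_of_maximal[OF C path_connectedin_imp_connectedin[OF N(3)]] \<open>x \<in> C\<close>
      by (auto simp: disjnt_iff)
    then show "\<exists>T. openin B T \<and> x \<in> T \<and> T \<subseteq> C"
      using N by blast
  qed
  obtain x where x: "x \<in> C"
    using C nonempty_connected_components_of by blast
  define Q where "Q = Collect (path_component_of B x)"
  have step: "y \<in> Q \<longleftrightarrow> z \<in> Q" if "path_connectedin B N" "y \<in> N" "z \<in> N" for y z N
    using that path_component_of_trans path_component_of_sym path_component_of
    unfolding Q_def by (metis mem_Collect_eq)
  have "openin B Q"
  proof (subst openin_subopen, intro ballI)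
    fix y assume y: "y \<in> Q"
    then have "y \<in> topspace B"
      by (auto simp: Q_def dest: path_component_in_topspace)
    then obtain N where "openin B N" "y \<in> N" "path_connectedin B N"
      using nbhd by blast
    then show "\<exists>T. openin B T \<and> y \<in> T \<and> T \<subseteq> Q"
      using step y by blast
  qed
  moreover have "openin B (topspace B - Q)"
  proof (subst openin_subopen, intro ballI)
    fix y assume y: "y \<in> topspace B - Q"
    then obtain N where N: "openin B N" "y \<in> N" "path_connectedin B N"
      using nbhd by blast
    then have "N \<subseteq> topspace B - Q"
      using step[OF N(3)] y openin_subset[OF N(1)] by blast
    then show "\<exists>T. openin B T \<and> y \<in> T \<and> T \<subseteq> topspace B - Q"
      using N by blast
  qed
  moreover have Qx: "x \<in> Q"
    using x CB by (auto simp: Q_def path_component_of_refl)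
  moreover have "Q \<subseteq> topspace B"
    by (auto simp: Q_def dest: path_component_in_topspace)
  ultimately have "closedin B Q" "openin B Q"
    by (auto simp: closedin_def)
  then have "C \<subseteq> Q"
    using connectedin_clopen_cases[OF connectedin_connected_components_of[OF C]] x Qx
    by (metis disjnt_iff)
  moreover have "Q \<subseteq> C"
    using connected_components_of_maximal[OF C path_connectedin_imp_connectedin[OF path_connectedin_path_component_of]]
      x Qx by (auto simp: disjnt_iff Q_def)
  ultimately show "path_connectedin B C"
    using path_connectedin_path_component_of[of B x] by (simp add: Q_def)
qed

text \<open>The image of a component of \<open>A\<close> is connected, open and closed, hence a component of \<open>B\<close>, and every
component of \<open>B\<close> arises in this way.  Compactness makes the number of components finite, so equality
of the numbers turns this surjection between the sets of components into a bijection.\<close>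

lemma component_preimage_is_component:
  assumes "compact_space A" "Hausdorff_space B" "continuous_map A B p" "open_map A B p"
    and surj: "p ` topspace A = topspace B"
    and nbhd: "\<And>x. x \<in> topspace A \<Longrightarrow> \<exists>N. openin A N \<and> x \<in> N \<and> path_connectedin A N"
    and card: "connected_components_of A \<approx> connected_components_of B"
    and C: "C \<in> connected_components_of B"
  shows "{x \<in> topspace A. p x \<in> C} \<in> connected_components_of A"
proof -
  let ?cA = "connected_components_of A" and ?cB = "connected_components_of B"
  have openD: "openin A D" if "D \<in> ?cA" for D
    using openin_component_if_path_connected_nbhds[OF nbhd that] .
  obtain \<F> where \<F>: "finite \<F>" "\<F> \<subseteq> ?cA" "topspace A \<subseteq> \<Union>\<F>"
    using assms(1) openD Union_connected_components_of[of A]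
    unfolding compact_space_def by (metis compactinD order_refl)
  have "?cA \<subseteq> \<F>"
  proof
    fix D assume D: "D \<in> ?cA"
    then obtain x where "x \<in> D" "x \<in> topspace A"
      using nonempty_connected_components_of connected_components_of_subset by blast
    then obtain E where "E \<in> \<F>" "x \<in> E"
      using \<F>(3) by blast
    then have "E = D"
      using connected_components_of_overlap[OF D, of E] \<F>(2) \<open>x \<in> D\<close> by blast
    then show "D \<in> \<F>"
      using \<open>E \<in> \<F>\<close> by simp
  qed
  then have fin: "finite ?cA"
    using \<F>(1) finite_subset by blast
  have img: "p ` D \<in> ?cB" if D: "D \<in> ?cA" for D
  proof -
    have DA: "D \<subseteq> topspace A"
      using D connected_components_of_subset by blast
    have conn: "connectedin B (p ` D)"
      using connectedin_continuous_map_image[OF assms(3) connectedin_connected_components_of[OF D]] .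
    obtain x where x: "x \<in> D"
      using D nonempty_connected_components_of by blast
    then have "p x \<in> topspace B"
      using DA surj by blast
    then obtain E where E: "E \<in> ?cB" "p x \<in> E"
      using Union_connected_components_of[of B] by blast
    have "p ` D \<subseteq> E"
      using connected_components_of_maximal[OF E(1) conn] E(2) x by (auto simp: disjnt_iff)
    moreover have "openin B (p ` D)"
      using assms(4) openD[OF D] by (simp add: open_map_def)
    moreover have "closedin A D"
      using D closedin_connected_components_of by blast
    then have "closedin B (p ` D)"
      using closedin_compact_space[OF assms(1)] image_compactin[OF _ assms(3)]
        compactin_imp_closedin[OF assms(2)] by blast
    ultimately have "E \<subseteq> p ` D"
      using connectedin_connected_components_of[OF E(1)] E(2) x
      by (metis connectedin_clopen_cases disjnt_iff image_eqI)
    then show ?thesis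
      using E(1) \<open>p ` D \<subseteq> E\<close> by (metis subset_antisym)
  qed
  have onto: "\<exists>D\<in>?cA. x \<in> D \<and> p ` D = E" if E: "E \<in> ?cB" and x: "x \<in> topspace A" "p x \<in> E" for E x
  proof -
    obtain D where D: "D \<in> ?cA" "x \<in> D"
      using x(1) Union_connected_components_of[of A] by blast
    then show ?thesis
      using connected_components_of_overlap[OF img[OF D(1)] E] x(2) by blast
  qed
  have "(`) p ` ?cA = ?cB"
  proof
    show "(`) p ` ?cA \<subseteq> ?cB"
      using img by blast
    show "?cB \<subseteq> (`) p ` ?cA"
    proof
      fix E assume E: "E \<in> ?cB"
      then obtain y where "y \<in> E" "y \<in> topspace B"
        using nonempty_connected_components_of connected_components_of_subset by blast
      then obtain x where "x \<in> topspace A" "p x \<in> E"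
        using surj by (metis imageE)
      then show "E \<in> (`) p ` ?cA"
        using onto[OF E] by blast
    qed
  qed
  moreover have "card ?cA = card ?cB"
    using card fin eqpoll_finite_iff[OF card] eqpoll_iff_card by blast
  ultimately have inj: "inj_on ((`) p) ?cA"
    using fin by (intro eq_card_imp_inj_on) auto
  obtain y where "y \<in> C" "y \<in> topspace B"
    using C nonempty_connected_components_of connected_components_of_subset by blast
  then obtain x where x: "x \<in> topspace A" "p x \<in> C"
    using surj by (metis imageE)
  then obtain D where D: "D \<in> ?cA" "x \<in> D" "p ` D = C"
    using onto[OF C] by blast
  have "{x \<in> topspace A. p x \<in> C} = D"
  proof
    show "{x \<in> topspace A. p x \<in> C} \<subseteq> D"
    proof
      fix z assume "z \<in> {x \<in> topspace A. p x \<in> C}"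
      then obtain D' where "D' \<in> ?cA" "z \<in> D'" "p ` D' = C"
        using onto[OF C, of z] by blast
      then show "z \<in> D"
        using inj D by (metis inj_onD)
    qed
    show "D \<subseteq> {x \<in> topspace A. p x \<in> C}"
      using D connected_components_of_subset by blast
  qed
  then show ?thesis
    using D(1) by simp
qed

section \<open>Local homeomorphisms on compact spaces and lifting\<close>

text \<open>These maps are finite coverings of their images, which are open and closed in \<open>C\<close>.  Here the covering
property takes the form of local sections through every point of the fibres (\<open>sections_near\<close>).\<close>

locale compact_local_homeomorphism =
  fixes K :: "'a topology" and C :: "'b topology" and p :: "'a \<Rightarrow> 'b"
  assumes compact: "compact_space K" and Hausdorff_K: "Hausdorff_space K"
    and Hausdorff_C: "Hausdorff_space C"
    and cont: "continuous_map K C p" and open_p: "open_map K C p"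
    and loc_inj: "\<And>x. x \<in> topspace K \<Longrightarrow> \<exists>U. openin K U \<and> x \<in> U \<and> inj_on p U"
begin

lemma closed_p: "closed_map K C p"
  using continuous_imp_closed_map_gen[OF compact Hausdorff_imp_kc_space[OF Hausdorff_C] cont] .

lemma compactin_fibre:
  assumes "c \<in> topspace C"
  shows "compactin K {x \<in> topspace K. p x = c}"
  using closedin_continuous_map_preimage[OF cont closedin_Hausdorff_singleton[OF Hausdorff_C assms]]
  by (intro closedin_compact_space[OF compact]) simp

lemma local_section:
  assumes "openin K U" "inj_on p U" "V \<subseteq> p ` U"
  shows "continuous_map (subtopology C V) K (inv_into U p)"
proof -
  have sub: "U \<subseteq> topspace K"
    using assms(1) openin_subset by blast
  have "openin (subtopology C V) {y \<in> topspace (subtopology C V). inv_into U p y \<in> T}"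
    if "openin K T" for T
  proof -
    have "inv_into U p y \<in> T \<longleftrightarrow> y \<in> p ` (U \<inter> T)" if y: "y \<in> V" for y
    proof -
      obtain u where "u \<in> U" "y = p u"
        using y assms(3) by blast
      then show ?thesis
        using assms(2) by (auto simp: inj_on_def inv_into_f_f)
    qed
    moreover have "V \<subseteq> topspace C"
      using assms(3) sub continuous_map_image_subset_topspace[OF cont] by blast
    ultimately have "{y \<in> topspace (subtopology C V). inv_into U p y \<in> T} = p ` (U \<inter> T) \<inter> V"
      by auto
    moreover have "openin C (p ` (U \<inter> T))"
      using open_p assms(1) that by (simp add: open_map_def openin_Int)
    ultimately show ?thesis
      by (simp add: openin_subtopology_Int)
  qed
  moreover have "inv_into U p y \<in> topspace K" if "y \<in> V" for y
    using assms(3) that sub inv_into_into by (metis subsetD)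
  ultimately show ?thesis
    by (auto simp: continuous_map_def)
qed

text \<open>The fibre over \<open>c\<close> is compact, so finitely many open sets on which \<open>p\<close> is injective cover it.  Their
images, minus the closed image of the points that they leave out, form a neighbourhood \<open>V\<close> of \<open>c\<close>:
each point over \<open>V\<close> lies in one of these sets \<open>U\<close>, and \<open>U\<close> contains a section over \<open>V\<close>.\<close>

lemma sections_near:
  assumes "c \<in> topspace C"
  obtains V where "openin C V" "c \<in> V"
    "\<And>x. x \<in> topspace K \<Longrightarrow> p x \<in> V \<Longrightarrow>
       \<exists>q. continuous_map (subtopology C V) K q \<and> (\<forall>y\<in>V. p (q y) = y) \<and> q (p x) = x"
proof -
  let ?F = "{x \<in> topspace K. p x = c}"
  let ?\<U> = "{U. openin K U \<and> inj_on p U \<and> c \<in> p ` U}"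
  have "?F \<subseteq> \<Union>?\<U>"
    using loc_inj by blast
  then obtain \<F> where \<F>: "finite \<F>" "\<F> \<subseteq> ?\<U>" "?F \<subseteq> \<Union>\<F>"
    using compactinD[OF compactin_fibre[OF assms], of ?\<U>] by auto
  define R where "R = p ` (topspace K - \<Union>\<F>)"
  have "openin K (\<Union>\<F>)"
    using \<F> by blast
  then have "closedin C R"
    using closed_p unfolding closed_map_def R_def by blast
  \<comment> \<open>The second factor also serves the case of an empty fibre, where \<open>\<F>\<close> may be empty.\<close>
  define V where "V = (\<Inter>U\<in>\<F>. p ` U) \<inter> (topspace C - R)"
  have "openin C V"
  proof (cases "\<F> = {}")
    case True
    then show ?thesis
      using \<open>closedin C R\<close> by (simp add: V_def closedin_def)
  next
    case False
    have "openin C (p ` U)" if "U \<in> \<F>" for U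
      using that \<F>(2) open_p by (auto simp: open_map_def)
    then have "openin C (\<Inter>((`) p ` \<F>))"
      using \<F>(1) False by (intro openin_Inter) auto
    then show ?thesis
      using \<open>closedin C R\<close> by (simp add: V_def closedin_def openin_Int)
  qed
  moreover have "c \<in> V"
    using assms \<F> by (auto simp: V_def R_def)
  moreover have "\<exists>q. continuous_map (subtopology C V) K q \<and> (\<forall>y\<in>V. p (q y) = y) \<and> q (p x) = x"
    if x: "x \<in> topspace K" "p x \<in> V" for x
  proof -
    obtain U where U: "U \<in> \<F>" "x \<in> U"
      using x by (auto simp: V_def R_def)
    have U': "openin K U" "inj_on p U" "V \<subseteq> p ` U"
      using U \<F>(2) by (auto simp: V_def)
    then have "\<forall>y\<in>V. p (inv_into U p y) = y"
      by (auto intro: f_inv_into_f)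
    then show ?thesis
      using local_section[OF U'] inv_into_f_f[OF U'(2) U(2)] by blast
  qed
  ultimately show ?thesis
    using that by blast
qed

text \<open>The set where two lifts agree is open by local injectivity and closed by the Hausdorff property.\<close>

lemma lift_unique:
  assumes "connected_space Z" "continuous_map Z K g" "continuous_map Z K g'"
    and eq: "\<And>z. z \<in> topspace Z \<Longrightarrow> p (g z) = p (g' z)"
    and "z0 \<in> topspace Z" "g z0 = g' z0" "z \<in> topspace Z"
  shows "g z = g' z"
proof -
  let ?E = "{z \<in> topspace Z. g z = g' z}"
  have gK: "g z \<in> topspace K" "g' z \<in> topspace K" if "z \<in> topspace Z" for z
    using assms(2,3) that by (auto simp: continuous_map_def)
  have pre: "openin Z ({z \<in> topspace Z. g z \<in> U} \<inter> {z \<in> topspace Z. g' z \<in> V})"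
    if "openin K U" "openin K V" for U V
    using openin_continuous_map_preimage assms(2,3) that by blast
  have "openin Z ?E"
  proof (subst openin_subopen, intro ballI)
    fix z assume z: "z \<in> ?E"
    then obtain U where U: "openin K U" "g z \<in> U" "inj_on p U"
      using loc_inj gK by blast
    have "{z \<in> topspace Z. g z \<in> U} \<inter> {z \<in> topspace Z. g' z \<in> U} \<subseteq> ?E"
      using U(3) eq by (auto dest: inj_onD)
    moreover have "z \<in> {z \<in> topspace Z. g z \<in> U} \<inter> {z \<in> topspace Z. g' z \<in> U}"
      using z U by auto
    ultimately show "\<exists>T. openin Z T \<and> z \<in> T \<and> T \<subseteq> ?E"
      using pre[OF U(1) U(1)] by blast
  qed
  moreover have "openin Z (topspace Z - ?E)"
  proof (subst openin_subopen, intro ballI)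
    fix z assume z: "z \<in> topspace Z - ?E"
    then obtain U V where UV: "openin K U" "openin K V" "g z \<in> U" "g' z \<in> V" "disjnt U V"
      using Hausdorff_K gK unfolding Hausdorff_space_def by (metis (mono_tags, lifting) DiffE mem_Collect_eq)
    have "{z \<in> topspace Z. g z \<in> U} \<inter> {z \<in> topspace Z. g' z \<in> V} \<subseteq> topspace Z - ?E"
      using UV(5) by (auto simp: disjnt_iff)
    moreover have "z \<in> {z \<in> topspace Z. g z \<in> U} \<inter> {z \<in> topspace Z. g' z \<in> V}"
      using z UV by auto
    ultimately show "\<exists>T. openin Z T \<and> z \<in> T \<and> T \<subseteq> topspace Z - ?E"
      using pre[OF UV(1,2)] by blast
  qed
  ultimately have "?E = {} \<or> ?E = topspace Z"
    using assms(1) unfolding connected_space_clopen_in closedin_def by blast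
  then show ?thesis
    using assms(5-7) by blast
qed

text \<open>For connected \<open>A\<close> this says that the covering pulled back along \<open>H\<close> is trivial over \<open>A\<close>.  Asking for a lift through each prescribed
point over each point of \<open>A\<close> makes the property stable under gluing.\<close>

definition lifts_from_each_point :: "('z::euclidean_space \<Rightarrow> 'b) \<Rightarrow> 'z set \<Rightarrow> bool" where
  "lifts_from_each_point H A \<longleftrightarrow>
     (\<forall>z\<in>A. \<forall>x\<in>topspace K. p x = H z \<longrightarrow>
        (\<exists>g. continuous_map (top_of_set A) K g \<and> (\<forall>w\<in>A. p (g w) = H w) \<and> g z = x))"

lemma lifts_from_each_point_locally:
  assumes "continuous_map (top_of_set S) C H" "z \<in> S"
  obtains N where "open N" "z \<in> N" "\<And>A. A \<subseteq> S \<inter> N \<Longrightarrow> lifts_from_each_point H A"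
proof -
  have "H z \<in> topspace C"
    using assms by (auto simp: continuous_map_def)
  then obtain V where V: "openin C V" "H z \<in> V"
    and sec: "\<And>x. x \<in> topspace K \<Longrightarrow> p x \<in> V \<Longrightarrow>
       \<exists>q. continuous_map (subtopology C V) K q \<and> (\<forall>y\<in>V. p (q y) = y) \<and> q (p x) = x"
    using sections_near by blast
  have "openin (top_of_set S) {w \<in> S. H w \<in> V}"
    using openin_continuous_map_preimage[OF assms(1) V(1)] by simp
  then obtain N where N: "open N" "{w \<in> S. H w \<in> V} = S \<inter> N"
    using openin_open by blast
  show ?thesis
  proof
    show "open N" "z \<in> N"
      using N assms(2) V(2) by auto
    fix A assume A: "A \<subseteq> S \<inter> N"
    then have HA: "H w \<in> V" if "w \<in> A" for w
      using N(2) that by blast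
    have "A \<subseteq> S"
      using A by blast
    then have contA: "continuous_map (top_of_set A) (subtopology C V) H"
      using continuous_map_from_subtopology_mono[OF assms(1)] HA
      by (auto simp: continuous_map_in_subtopology)
    show "lifts_from_each_point H A"
      unfolding lifts_from_each_point_def
    proof (intro ballI impI)
      fix w x assume w: "w \<in> A" and x: "x \<in> topspace K" "p x = H w"
      then obtain q where q: "continuous_map (subtopology C V) K q" "\<forall>y\<in>V. p (q y) = y" "q (p x) = x"
        using sec HA by metis
      show "\<exists>g. continuous_map (top_of_set A) K g \<and> (\<forall>w\<in>A. p (g w) = H w) \<and> g w = x"
        using continuous_map_compose[OF contA q(1)] q(2,3) HA x(2)
        by (intro exI[of _ "q \<circ> H"]) auto
    qed
  qed
qed

lemma lifts_from_each_point_Un: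
  assumes A: "lifts_from_each_point H A" "closed A" and B: "lifts_from_each_point H B" "closed B"
    and AB: "connected (A \<inter> B)" "A \<inter> B \<noteq> {}"
  shows "lifts_from_each_point H (A \<union> B)"
proof -
  have main: "\<exists>g. continuous_map (top_of_set (A \<union> B)) K g \<and> (\<forall>w\<in>A \<union> B. p (g w) = H w) \<and> g z = x"
    if A: "lifts_from_each_point H A" "closed A" and B: "lifts_from_each_point H B" "closed B"
      and AB: "connected (A \<inter> B)" "A \<inter> B \<noteq> {}"
      and z: "z \<in> A" and x: "x \<in> topspace K" "p x = H z" for A B z x
  proof -
    obtain g where g: "continuous_map (top_of_set A) K g" "\<forall>w\<in>A. p (g w) = H w" "g z = x"
      using A(1) z x unfolding lifts_from_each_point_def by blast
    obtain y where y: "y \<in> A" "y \<in> B"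
      using AB(2) by blast
    then have "g y \<in> topspace K" "p (g y) = H y"
      using g by (auto simp: continuous_map_def)
    then obtain g' where g': "continuous_map (top_of_set B) K g'" "\<forall>w\<in>B. p (g' w) = H w" "g' y = g y"
      using B(1) y unfolding lifts_from_each_point_def by blast
    have agree: "g w = g' w" if "w \<in> A \<inter> B" for w
    proof (rule lift_unique[of "top_of_set (A \<inter> B)" g g' y])
      show "connected_space (top_of_set (A \<inter> B))"
        using AB(1) connectedin_def[of euclidean "A \<inter> B"] by simp
      show "continuous_map (top_of_set (A \<inter> B)) K g" "continuous_map (top_of_set (A \<inter> B)) K g'"
        using g(1) g'(1) continuous_map_from_subtopology_mono by (metis Int_lower1 Int_lower2)+
    qed (use that g g' y in auto)
    let ?h = "\<lambda>w. if w \<in> A then g w else g' w"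
    have "continuous_map (top_of_set (A \<union> B)) K ?h"
    proof (rule pasting_lemma_closed[where I="UNIV :: bool set" and T="\<lambda>b. if b then A else B"
          and f="\<lambda>b. if b then g else g'"])
      show "closedin (top_of_set (A \<union> B)) (if b then A else B)" for b
        using A(2) B(2) by (auto simp: closed_subset)
      show "continuous_map (subtopology (top_of_set (A \<union> B)) (if b then A else B)) K (if b then g else g')" for b
        using g(1) g'(1) by (auto simp: subtopology_subtopology Int_absorb1 inf.absorb2)
    qed (use agree in \<open>auto split: if_splits\<close>)
    moreover have "\<forall>w\<in>A \<union> B. p (?h w) = H w"
      using g(2) g'(2) by auto
    ultimately show ?thesis
      using z g(3) by (intro exI[of _ ?h]) auto
  qed
  show ?thesis
    unfolding lifts_from_each_point_def
  proof (intro ballI impI)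
    fix z x assume "z \<in> A \<union> B" "x \<in> topspace K" "p x = H z"
    then show "\<exists>g. continuous_map (top_of_set (A \<union> B)) K g \<and> (\<forall>w\<in>A \<union> B. p (g w) = H w) \<and> g z = x"
      using main[OF A B AB, of z x] main[OF B A, of z x] AB by (auto simp: Int_commute Un_commute)
  qed
qed

text \<open>Subdivision of the square, organised as two applications of the bisection principle \<open>Bolzano\<close>: the
first one joins small rectangles to a thin strip of full width around a given height \<open>t\<close>, the second
one stacks strips.  At each gluing the two pieces share a segment, which is connected, so a lift over
one piece and a lift over the other that agree at one point of it agree on all of it.\<close>

lemma lifts_from_each_point_square:
  fixes H :: "real \<times> real \<Rightarrow> 'b"
  assumes H: "continuous_map (top_of_set ({0..1} \<times> {0..1})) C H"
  shows "lifts_from_each_point H ({0..1} \<times> {0..1})"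
proof -
  let ?L = "\<lambda>a b c d. lifts_from_each_point H ({a..b} \<times> {c..d})"
  have strip: "\<exists>\<delta>>0. \<forall>c d. 0 \<le> c \<and> d \<le> 1 \<and> c \<le> t \<and> t \<le> d \<and> d - c < \<delta> \<longrightarrow> ?L 0 1 c d"
    if t: "0 \<le> t" "t \<le> 1" for t
  proof -
    \<comment> \<open>The width \<open>\<delta>\<close> of the strip may depend on the rectangle; gluing two of them takes the minimum.\<close>
    define P where "P a b \<longleftrightarrow> (0 \<le> a \<and> b \<le> 1 \<longrightarrow>
      (\<exists>\<delta>>0. \<forall>c d. 0 \<le> c \<and> d \<le> 1 \<and> c \<le> t \<and> t \<le> d \<and> d - c < \<delta> \<longrightarrow> ?L a b c d))" for a b
    have "P 0 1"
    proof (rule Bolzano)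
      show "0 \<le> (1::real)" by simp
    next
      fix a b e
      assume trans: "P a b" "P b e" "a \<le> b" "b \<le> e"
      show "P a e"
        unfolding P_def
      proof
        assume ae: "0 \<le> a \<and> e \<le> 1"
        then obtain \<delta>1 \<delta>2 where \<delta>: "\<delta>1 > 0" "\<delta>2 > 0"
          and L1: "\<forall>c d. 0 \<le> c \<and> d \<le> 1 \<and> c \<le> t \<and> t \<le> d \<and> d - c < \<delta>1 \<longrightarrow> ?L a b c d"
          and L2: "\<forall>c d. 0 \<le> c \<and> d \<le> 1 \<and> c \<le> t \<and> t \<le> d \<and> d - c < \<delta>2 \<longrightarrow> ?L b e c d"
          using trans unfolding P_def by fastforce
        have "?L a e c d" if cd: "0 \<le> c \<and> d \<le> 1 \<and> c \<le> t \<and> t \<le> d \<and> d - c < min \<delta>1 \<delta>2" for c d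
        proof -
          have U: "{a..e} \<times> {c..d} = {a..b} \<times> {c..d} \<union> {b..e} \<times> {c..d}"
            and I: "({a..b} \<times> {c..d}) \<inter> ({b..e} \<times> {c..d}) = {b} \<times> {c..d}"
            using trans by auto
          show ?thesis
            unfolding U
            by (rule lifts_from_each_point_Un)
              (use L1 L2 cd in \<open>auto simp: I closed_Times connected_Times\<close>)
        qed
        then show "\<exists>\<delta>>0. \<forall>c d. 0 \<le> c \<and> d \<le> 1 \<and> c \<le> t \<and> t \<le> d \<and> d - c < \<delta> \<longrightarrow> ?L a e c d"
          using \<delta> by (intro exI[of _ "min \<delta>1 \<delta>2"]) auto
      qed
    next
      fix s :: real
      assume "0 \<le> s" "s \<le> 1"
      then obtain N where N: "open N" "(s, t) \<in> N"
        "\<And>A. A \<subseteq> ({0..1} \<times> {0..1}) \<inter> N \<Longrightarrow> lifts_from_each_point H A"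
        using lifts_from_each_point_locally[OF H, of "(s, t)"] t by auto
      then obtain e where e: "e > 0" "ball (s, t) e \<subseteq> N"
        using open_contains_ball by blast
      have "?L a b c d"
        if "a \<le> s \<and> s \<le> b \<and> b - a < e / 2" "0 \<le> a \<and> b \<le> 1"
          "0 \<le> c \<and> d \<le> 1 \<and> c \<le> t \<and> t \<le> d \<and> d - c < e / 2" for a b c d
      proof (rule N(3))
        have "dist (s, t) (s', t') < e" if "s' \<in> {a..b}" "t' \<in> {c..d}" for s' t'
        proof -
          have "dist (s, t) (s', t') \<le> \<bar>s - s'\<bar> + \<bar>t - t'\<bar>"
            unfolding dist_Pair_Pair dist_real_def using sqrt_sum_squares_le_sum_abs[of "s - s'" "t - t'"] by simp
          then show ?thesis
            using that \<open>a \<le> s \<and> s \<le> b \<and> b - a < e / 2\<close>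
              \<open>0 \<le> c \<and> d \<le> 1 \<and> c \<le> t \<and> t \<le> d \<and> d - c < e / 2\<close> by auto
        qed
        then show "{a..b} \<times> {c..d} \<subseteq> ({0..1} \<times> {0..1}) \<inter> N"
          using that e(2) by auto
      qed
      then show "\<exists>\<delta>>0. \<forall>a b. a \<le> s \<and> s \<le> b \<and> b - a < \<delta> \<longrightarrow> P a b"
        unfolding P_def using half_gt_zero[OF e(1)] by blast
    qed
    then show ?thesis by (simp add: P_def)
  qed
  define P where "P c d \<longleftrightarrow> (0 \<le> c \<and> d \<le> 1 \<longrightarrow> ?L 0 1 c d)" for c d
  have "P 0 1"
  proof (rule Bolzano)
    show "0 \<le> (1::real)" by simp
  next
    fix a b e
    assume trans: "P a b" "P b e" "a \<le> b" "b \<le> e"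
    show "P a e"
      unfolding P_def
    proof
      assume ae: "0 \<le> a \<and> e \<le> 1"
      have U: "{0..1::real} \<times> {a..e} = {0..1} \<times> {a..b} \<union> {0..1} \<times> {b..e}"
        and I: "({0..1::real} \<times> {a..b}) \<inter> ({0..1} \<times> {b..e}) = {0..1} \<times> {b}"
        using trans by auto
      have "?L 0 1 a b" "?L 0 1 b e"
        using trans ae by (auto simp: P_def)
      then show "?L 0 1 a e"
        unfolding U by (intro lifts_from_each_point_Un) (auto simp: I closed_Times connected_Times)
    qed
  next
    fix t :: real
    assume "0 \<le> t" "t \<le> 1"
    then show "\<exists>\<delta>>0. \<forall>c d. c \<le> t \<and> t \<le> d \<and> d - c < \<delta> \<longrightarrow> P c d"
      unfolding P_def using strip[of t] by blast
  qed
  then show ?thesis by (simp add: P_def)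
qed

text \<open>Join two points \<open>a\<close>, \<open>b\<close> of a fibre by a path \<open>\<gamma>\<close>.  The loop \<open>p \<circ> \<gamma>\<close> is freely homotopic to a constant
one through loops; lift the homotopy.  Its lift ends in a lift of a constant loop, which is constant.
Its two edges \<open>s \<mapsto> G (s, 0)\<close> and \<open>s \<mapsto> G (s, 1)\<close> lift the same path, since every stage of the
homotopy is a loop, and they agree at \<open>s = 1\<close>.  Hence they agree at \<open>s = 0\<close>, where they are \<open>a\<close>
and \<open>b\<close>.\<close>

lemma inj_on_if_simply_connected_base:
  assumes "path_connected_space K" "simply_connected_space C"
  shows "inj_on p (topspace K)"
proof (rule inj_onI)
  fix a b assume a: "a \<in> topspace K" and b: "b \<in> topspace K" and ab: "p a = p b"
  let ?I = "{0..1::real}"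
  obtain \<gamma> where \<gamma>: "continuous_map (top_of_set ?I) K \<gamma>" "\<gamma> 0 = a" "\<gamma> 1 = b"
    using assms(1) a b unfolding path_connected_space_def pathin_def by blast
  have "pathin C (p \<circ> \<gamma>)" "(p \<circ> \<gamma>) 1 = (p \<circ> \<gamma>) 0"
    using \<gamma> ab continuous_map_compose[OF \<gamma>(1) cont] by (auto simp: pathin_def)
  moreover have "pathin C (\<lambda>_. p a)"
    using a cont by (auto simp: pathin_def continuous_map_def)
  ultimately have "homotopic_with (\<lambda>h. h 1 = h 0) (top_of_set ?I) C (p \<circ> \<gamma>) (\<lambda>_. p a)"
    using assms(2)[unfolded simply_connected_space_def, rule_format, of "p \<circ> \<gamma>" "\<lambda>_. p a"] by blast
  then obtain H where H: "continuous_map (top_of_set (?I \<times> ?I)) C H"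
    and H0: "\<And>t. H (0, t) = p (\<gamma> t)" and H1: "\<And>t. H (1, t) = p a"
    and loop: "\<And>s. s \<in> ?I \<Longrightarrow> H (s, 1) = H (s, 0)"
    unfolding homotopic_with_def by auto
  have "(0, 0) \<in> ?I \<times> ?I" "p a = H (0, 0)"
    using H0 \<gamma>(2) by auto
  then obtain G where G: "continuous_map (top_of_set (?I \<times> ?I)) K G"
    and lift: "\<And>s t. s \<in> ?I \<Longrightarrow> t \<in> ?I \<Longrightarrow> p (G (s, t)) = H (s, t)" and G00: "G (0, 0) = a"
    using lifts_from_each_point_square[OF H] a unfolding lifts_from_each_point_def by blast
  have conn: "connected_space (top_of_set ?I)"
    using connectedin_def[of euclidean ?I] by simp
  have G_row: "continuous_map (top_of_set ?I) K (\<lambda>t. G (s, t))" if "s \<in> ?I" for s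
  proof -
    have "continuous_on ?I (\<lambda>t. (s, t))"
      by (intro continuous_intros)
    then show ?thesis
      using continuous_map_compose[OF _ G, of "top_of_set ?I" "\<lambda>t. (s, t)"] that
      by (auto simp: o_def continuous_map_in_subtopology)
  qed
  have G_col: "continuous_map (top_of_set ?I) K (\<lambda>s. G (s, t))" if "t \<in> ?I" for t
  proof -
    have "continuous_on ?I (\<lambda>s. (s, t))"
      by (intro continuous_intros)
    then show ?thesis
      using continuous_map_compose[OF _ G, of "top_of_set ?I" "\<lambda>s. (s, t)"] that
      by (auto simp: o_def continuous_map_in_subtopology)
  qed
  have "G (0, 1) = \<gamma> 1"
    by (rule lift_unique[OF conn G_row \<gamma>(1), of 0 0 1]) (use lift H0 G00 \<gamma>(2) in auto)
  moreover have "G (1, 1) = G (1, 0)"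
  proof (rule lift_unique[OF conn G_row, of 1 "\<lambda>_. G (1, 0)" 0 1])
    show "continuous_map (top_of_set ?I) K (\<lambda>_. G (1, 0))"
      using G by (auto simp: continuous_map_def)
  qed (use lift H1 in auto)
  then have "G (0, 1) = G (0, 0)"
    by (intro lift_unique[OF conn G_col G_col, of 1 0 1 0]) (use lift loop in auto)
  ultimately show "a = b"
    using G00 \<gamma>(3) by simp
qed

lemma restriction:
  assumes "closedin C D"
  shows "compact_local_homeomorphism (subtopology K {x \<in> topspace K. p x \<in> D}) (subtopology C D) p"
proof
  let ?E = "{x \<in> topspace K. p x \<in> D}"
  show "compact_space (subtopology K ?E)"
    using closedin_compact_space[OF compact closedin_continuous_map_preimage[OF cont assms]]
    by (simp add: compactin_subspace)
  show "Hausdorff_space (subtopology K ?E)" "Hausdorff_space (subtopology C D)"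
    using Hausdorff_K Hausdorff_C Hausdorff_space_subtopology by blast+
  show "continuous_map (subtopology K ?E) (subtopology C D) p"
    using cont by (auto simp: continuous_map_in_subtopology continuous_map_from_subtopology)
  show "open_map (subtopology K ?E) (subtopology C D) p"
    using open_map_restriction[OF open_p] by blast
  show "\<exists>U. openin (subtopology K ?E) U \<and> x \<in> U \<and> inj_on p U" if x: "x \<in> topspace (subtopology K ?E)" for x
  proof -
    obtain U where U: "openin K U" "x \<in> U" "inj_on p U"
      using loc_inj x by auto
    then have "inj_on p (U \<inter> ?E)"
      using inj_on_subset by blast
    then show ?thesis
      using U x openin_subtopology_Int[of K U ?E] by (intro exI[of _ "U \<inter> ?E"]) auto
  qed
qed

lemma surj_if_connected:
  assumes "connected_space C" "topspace K \<noteq> {}"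
  shows "p ` topspace K = topspace C"
proof -
  have "openin C (p ` topspace K)" "closedin C (p ` topspace K)"
    using open_p closed_p unfolding open_map_def closed_map_def by blast+
  then show ?thesis
    using assms unfolding connected_space_clopen_in by blast
qed

text \<open>The number of preimages is locally constant; for the value one this can be seen directly.  Around a
single preimage, \<open>p\<close> is injective, and nearby fibres cannot have points elsewhere since \<open>p\<close> is closed.
Two distinct preimages have disjoint neighbourhoods whose images are open, and a point without
preimage is outside the closed image of \<open>p\<close>.\<close>

lemma bij_betw_if_unique_preimage:
  assumes "connected_space C" "c \<in> topspace C" "\<exists>!x. x \<in> topspace K \<and> p x = c"
  shows "bij_betw p (topspace K) (topspace C)"
proof -
  let ?E = "{y \<in> topspace C. \<exists>!x. x \<in> topspace K \<and> p x = y}"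
  have op: "openin C (p ` U)" if "openin K U" for U
    using open_p that by (simp add: open_map_def)
  have cl: "openin C (topspace C - p ` (topspace K - U))" if "openin K U" for U
  proof -
    have "closedin C (p ` (topspace K - U))"
      using closed_p that unfolding closed_map_def by blast
    then show ?thesis
      by blast
  qed
  have "openin C ?E"
  proof (subst openin_subopen, intro ballI)
    fix y assume y: "y \<in> ?E"
    then obtain x where x: "x \<in> topspace K" "p x = y" "\<And>z. z \<in> topspace K \<Longrightarrow> p z = y \<Longrightarrow> z = x"
      by blast
    then obtain U where U: "openin K U" "x \<in> U" "inj_on p U"
      using loc_inj by blast
    define V where "V = p ` U \<inter> (topspace C - p ` (topspace K - U))"
    have "openin C V"
      unfolding V_def by (rule openin_Int[OF op[OF U(1)] cl[OF U(1)]])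
    moreover have "y \<in> V"
      unfolding V_def using y x(2,3) U(2) by blast
    moreover have "V \<subseteq> ?E"
    proof
      fix z assume z: "z \<in> V"
      then obtain u where u: "u \<in> U" "p u = z"
        by (auto simp: V_def)
      have "u' = u" if "u' \<in> topspace K" "p u' = z" for u'
        using z that u U(3) by (auto simp: V_def inj_on_def)
      then show "z \<in> ?E"
        using z u openin_subset[OF U(1)] by (auto simp: V_def)
    qed
    ultimately show "\<exists>T. openin C T \<and> y \<in> T \<and> T \<subseteq> ?E"
      by blast
  qed
  moreover have "openin C (topspace C - ?E)"
  proof (subst openin_subopen, intro ballI)
    fix y assume y: "y \<in> topspace C - ?E"
    show "\<exists>T. openin C T \<and> y \<in> T \<and> T \<subseteq> topspace C - ?E"
    proof (cases "y \<in> p ` topspace K")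
      case False
      have "openin C (topspace C - p ` topspace K)"
        using cl[of "{}"] by simp
      moreover have "topspace C - p ` topspace K \<subseteq> topspace C - ?E"
        by blast
      ultimately show ?thesis
        using y False by blast
    next
      case True
      then obtain a b where ab: "a \<in> topspace K" "b \<in> topspace K" "p a = y" "p b = y" "a \<noteq> b"
        using y by blast
      then obtain U V where UV: "openin K U" "openin K V" "a \<in> U" "b \<in> V" "disjnt U V"
        using Hausdorff_K unfolding Hausdorff_space_def by metis
      have "openin C (p ` U \<inter> p ` V)"
        using op UV by blast
      moreover have "y \<in> p ` U \<inter> p ` V"
        using ab(3,4) UV(3,4) by (metis IntI imageI)
      moreover have "p ` U \<inter> p ` V \<subseteq> topspace C - ?E"
      proof
        fix z assume z: "z \<in> p ` U \<inter> p ` V"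
        then have "z \<in> p ` U" "z \<in> p ` V"
          by auto
        then obtain u v where uv: "u \<in> U" "v \<in> V" "p u = z" "p v = z"
          by (metis imageE)
        then have "u \<noteq> v" "u \<in> topspace K" "v \<in> topspace K"
          using UV openin_subset by (auto simp: disjnt_iff)
        moreover have "z \<in> topspace C"
          using z openin_subset[OF op[OF UV(1)]] by blast
        ultimately show "z \<in> topspace C - ?E"
          using uv by blast
      qed
      ultimately show ?thesis
        by blast
    qed
  qed
  ultimately have "?E = {} \<or> ?E = topspace C"
    using assms(1) unfolding connected_space_clopen_in closedin_def by blast
  then have E: "\<exists>!x. x \<in> topspace K \<and> p x = y" if "y \<in> topspace C" for y
    using assms(2,3) that by blast
  have img: "p x \<in> topspace C" if "x \<in> topspace K" for x
    using cont that by (auto simp: continuous_map_def)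
  show ?thesis
  proof (rule bij_betw_imageI)
    show "inj_on p (topspace K)"
      using E img by (auto simp: inj_on_def)
    show "p ` topspace K = topspace C"
      using E img by blast
  qed
qed

end

section \<open>Immersions that preserve the boundary\<close>

text \<open>The extension \<open>g\<close> of the local map has an honest derivative at \<open>\<phi> x\<close>, which coincides with the
differential of \<open>f\<close> computed within the domain of the local map.  So the rank condition makes the
derivative of \<open>g\<close> invertible and the inverse function theorem applies to \<open>g\<close>.\<close>

lemma regular_local_representation:
  fixes f :: "'a \<Rightarrow> 'b" and M N :: "(real ^ 'n::{finite,wellorder}) set" and r :: enat
  assumes "1 \<le> r" and c: "model_chart M X U \<phi>" and d: "model_chart N Y V \<psi>"
    and f: "continuous_map X Y f"
    and Cr: "Cr_on r (local_map (U, \<phi>) (V, \<psi>) f) (local_domain (U, \<phi>) (V, \<psi>) f)"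
    and x: "x \<in> U" "f x \<in> V"
    and D: "(local_map (U, \<phi>) (V, \<psi>) f has_derivative D)
        (at (\<phi> x) within local_domain (U, \<phi>) (V, \<psi>) f)" "rank (matrix D) = CARD('n)"
  obtains P Q g h where "open P" "open Q" "homeomorphism P Q g h" "\<phi> x \<in> P"
    "\<And>k. enat k \<le> r \<Longrightarrow> Ck_on k h Q"
    "\<And>u. u \<in> U \<Longrightarrow> f u \<in> V \<Longrightarrow> \<phi> u \<in> P \<Longrightarrow> g (\<phi> u) = \<psi> (f u)"
proof -
  define A where "A = local_domain (U, \<phi>) (V, \<psi>) f"
  define F where "F = local_map (U, \<phi>) (V, \<psi>) f"
  have A: "A = \<phi> ` (U \<inter> f -` V)"
    by (simp add: A_def local_domain_def)
  have F: "F (\<phi> u) = \<psi> (f u)" if "u \<in> U" for u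
    using that model_chart_inj[OF c] by (simp add: F_def local_map_def inv_into_f_f)
  have "U \<inter> f -` V = U \<inter> {x \<in> topspace X. f x \<in> V}"
    using model_chart_subset[OF c] by blast
  moreover have "openin X {x \<in> topspace X. f x \<in> V}"
    using openin_continuous_map_preimage[OF f] d by (simp add: model_chart_def)
  ultimately have "openin X (U \<inter> f -` V)"
    using c by (simp add: model_chart_def openin_Int)
  then have opA: "openin (top_of_set M) A"
    using model_chart_openin_image[OF c] by (simp add: A)
  have xA: "\<phi> x \<in> A"
    using x by (auto simp: A)
  obtain W g where W: "open W" "\<phi> x \<in> W" "\<And>k. enat k \<le> r \<Longrightarrow> Ck_on k g W"
    "\<And>y. y \<in> A \<inter> W \<Longrightarrow> g y = F y"
    using Cr xA unfolding Cr_on_def A_def F_def by metis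
  have "enat (Suc 0) \<le> r"
    using \<open>1 \<le> r\<close> by (simp add: one_enat_def)
  then have "g differentiable (at (\<phi> x))"
    using W(2,3) by fastforce
  then obtain D' where D': "(g has_derivative D') (at (\<phi> x))"
    by (auto simp: differentiable_def)
  obtain e where e: "e > 0" "ball (\<phi> x) e \<subseteq> W"
    using W(1,2) open_contains_ball by blast
  have "(F has_derivative D') (at (\<phi> x) within A)"
  proof (rule has_derivative_transform_within[OF _ e(1) xA])
    show "(g has_derivative D') (at (\<phi> x) within A)"
      using D' has_derivative_at_withinI by blast
    show "g y = F y" if "y \<in> A" "dist y (\<phi> x) < e" for y
      using W(4)[of y] that e(2) by (auto simp: dist_commute)
  qed
  then have "D' = D"
    using euclidean_model_has_derivative_unique[OF _ opA xA] D(1) c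
    unfolding A_def F_def model_chart_def by blast
  have "inj ((*v) (matrix D))"
    using D(2) full_rank_injective by blast
  moreover have "(*v) (matrix D) = D"
    using D(1) has_derivative_linear matrix_vector_mul(2) by blast
  ultimately have "inj D'"
    using \<open>D' = D\<close> by simp
  obtain P Q h where PQ: "open P" "P \<subseteq> W" "\<phi> x \<in> P" "open Q" "homeomorphism P Q g h"
    "\<And>k. enat k \<le> r \<Longrightarrow> Ck_on k h Q"
    using Ck_inverse_function_theorem[OF \<open>1 \<le> r\<close> W(1,2,3) D' \<open>inj D'\<close>] by metis
  show ?thesis
  proof (rule that[OF PQ(1,4,5,3,6)])
    show "g (\<phi> u) = \<psi> (f u)" if "u \<in> U" "f u \<in> V" "\<phi> u \<in> P" for u
      using W(4)[of "\<phi> u"] F[OF that(1)] that PQ(2) by (auto simp: A)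
  qed
qed

text \<open>The image of a Euclidean neighbourhood of \<open>\<phi> x\<close> is open in the surrounding space and contained in the
model \<open>N\<close>.\<close>

lemma regular_point_interior:
  fixes M N :: "(real ^ 'n::{finite,wellorder}) set"
  assumes c: "model_chart M X U \<phi>" and d: "model_chart N Y V \<psi>"
    and S: "openin X S" "S \<subseteq> U" "f ` S \<subseteq> V" "\<phi> ` S \<subseteq> P"
    and hom: "homeomorphism P Q g h" "open Q" and rep: "\<And>u. u \<in> S \<Longrightarrow> g (\<phi> u) = \<psi> (f u)"
    and x: "x \<in> S" "\<phi> x \<in> interior M"
  shows "\<psi> (f x) \<in> interior N"
proof -
  obtain T where T: "open T" "\<phi> ` S = M \<inter> T"
    using model_chart_openin_image[OF c S(1,2)] openin_open by metis
  have sub: "interior M \<inter> T \<subseteq> \<phi> ` S"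
    using T(2) interior_subset by blast
  have "open (g ` (interior M \<inter> T))"
    by (rule homeomorphism_open_image[OF hom]) (use T sub S(4) in auto)
  moreover have "g ` \<phi> ` S = \<psi> ` f ` S"
    using rep by (simp add: image_image)
  then have "g ` (interior M \<inter> T) \<subseteq> N"
    using image_mono[OF sub, of g] image_mono[OF S(3), of \<psi>] model_chart_image[OF d] by simp
  moreover have "\<psi> (f x) \<in> g ` (interior M \<inter> T)"
    using x T rep by (intro image_eqI[of _ _ "\<phi> x"]) auto
  ultimately show ?thesis
    by (meson interiorI)
qed

lemma openin_image_of_regular_nbhd:
  fixes M N :: "(real ^ 'n::{finite,wellorder}) set"
  assumes c: "model_chart M X U \<phi>" and d: "model_chart N Y V \<psi>"
    and S: "openin X S" "S \<subseteq> U" "f ` S \<subseteq> V" "\<phi> ` S \<subseteq> P"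
    and hom: "homeomorphism P Q g h" "open P" "open Q"
    and rep: "\<And>u. u \<in> S \<Longrightarrow> g (\<phi> u) = \<psi> (f u)"
    and bd: "\<And>u. u \<in> S \<Longrightarrow> u \<in> manifold_boundary TYPE('n) X \<longleftrightarrow> f u \<in> manifold_boundary TYPE('n) Y"
  shows "openin Y (f ` S)"
proof -
  have gS: "g ` \<phi> ` S = \<psi> ` f ` S"
    using rep by (simp add: image_image)
  have "openin (top_of_set N) (g ` \<phi> ` S)"
  proof (rule local_homeomorphism_of_models_open[OF _ _ hom _ S(4)])
    show "euclidean_model M" "euclidean_model N"
      using c d by (auto simp: model_chart_def)
    show "openin (top_of_set M) (\<phi> ` S)"
      using model_chart_openin_image[OF c S(1,2)] .
    show "g ` \<phi> ` S \<subseteq> N"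
      using gS S(3) model_chart_image[OF d] by blast
    show "p \<in> interior M \<longleftrightarrow> g p \<in> interior N" if "p \<in> \<phi> ` S" for p
      using that rep bd S(2,3) model_chart_boundary_iff[OF c] model_chart_boundary_iff[OF d]
      by (auto simp: image_subset_iff subset_iff)
  qed
  then have "openin Y {v \<in> V. \<psi> v \<in> \<psi> ` f ` S}"
    using model_chart_openin_preimage[OF d] gS by simp
  moreover have "{v \<in> V. \<psi> v \<in> \<psi> ` f ` S} = f ` S"
    using S(3) model_chart_inj[OF d] by (auto simp: inj_on_def)
  ultimately show ?thesis by simp
qed

text \<open>The local part of the argument takes place here: it shows that \<open>f\<close> is open and locally injective and
reflects the boundary.  Compactness of \<open>X\<close> enters only with the covering argument.\<close>

locale boundary_preserving_immersion =
  fixes r :: enat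
    and X :: "'a topology" and \<CC> :: "('a, 'n::{finite,wellorder}) chart set set"
    and Y :: "'b topology" and \<DD> :: "('b, 'n) chart set set"
    and f :: "'a \<Rightarrow> 'b"
  assumes r: "1 \<le> r"
    and X: "Cr_manifold r X \<CC>" and Y: "Cr_manifold r Y \<DD>"
    and f: "Cr_mapping r X \<CC> Y \<DD> f"
    and df: "nondegenerate_differential X \<CC> \<DD> f"
    and boundary_subset: "f ` manifold_boundary TYPE('n) X \<subseteq> manifold_boundary TYPE('n) Y"
begin

lemma continuous: "continuous_map X Y f"
  using f by (simp add: Cr_mapping_def)

lemma representation_at:
  assumes c: "(U, \<phi>) \<in> \<Union>\<CC>" and d: "(V, \<psi>) \<in> \<Union>\<DD>" and x: "x \<in> U" "f x \<in> V"
  obtains M N P Q g h S where "model_chart M X U \<phi>" "model_chart N Y V \<psi>"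
    "open P" "open Q" "homeomorphism P Q g h" "\<And>k. enat k \<le> r \<Longrightarrow> Ck_on k h Q"
    "openin X S" "x \<in> S" "S \<subseteq> U" "f ` S \<subseteq> V" "\<phi> ` S \<subseteq> P"
    "\<And>u. u \<in> S \<Longrightarrow> g (\<phi> u) = \<psi> (f u)"
proof -
  obtain M where M: "model_chart M X U \<phi>"
    using is_chart_imp_model_chart Cr_manifold_is_chart[OF X c] by metis
  obtain N where N: "model_chart N Y V \<psi>"
    using is_chart_imp_model_chart Cr_manifold_is_chart[OF Y d] by metis
  have "x \<in> topspace X"
    using model_chart_subset[OF M] x(1) by blast
  then have "has_differential_rank \<CC> \<DD> f x CARD('n)"
    using df by (simp add: nondegenerate_differential_def)
  from this[unfolded has_differential_rank_def, rule_format, OF c d]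
  obtain D where D: "(local_map (U, \<phi>) (V, \<psi>) f has_derivative D)
      (at (\<phi> x) within local_domain (U, \<phi>) (V, \<psi>) f)" "rank (matrix D) = CARD('n)"
    using x by auto
  have Cr: "Cr_on r (local_map (U, \<phi>) (V, \<psi>) f) (local_domain (U, \<phi>) (V, \<psi>) f)"
    using f[unfolded Cr_mapping_def] c d by blast
  obtain P Q g h where PQ: "open P" "open Q" "homeomorphism P Q g h" "\<phi> x \<in> P"
    "\<And>k. enat k \<le> r \<Longrightarrow> Ck_on k h Q"
    "\<And>u. u \<in> U \<Longrightarrow> f u \<in> V \<Longrightarrow> \<phi> u \<in> P \<Longrightarrow> g (\<phi> u) = \<psi> (f u)"
    using regular_local_representation[OF r M N continuous Cr x D] by metis
  \<comment> \<open>On \<open>S\<close> the conditions under which \<open>g\<close> represents \<open>f\<close> hold at every point.\<close>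
  define S where "S = {u \<in> U. \<phi> u \<in> M \<inter> P} \<inter> {u \<in> topspace X. f u \<in> V}"
  have "openin X {u \<in> U. \<phi> u \<in> M \<inter> P}"
    by (rule model_chart_openin_preimage[OF M openin_open_Int[OF PQ(1)]])
  moreover have "openin X {u \<in> topspace X. f u \<in> V}"
    using openin_continuous_map_preimage[OF continuous] N by (simp add: model_chart_def)
  ultimately have "openin X S"
    by (simp add: S_def openin_Int)
  moreover have "x \<in> S"
    using x PQ(4) model_chart_image[OF M] \<open>x \<in> topspace X\<close> by (auto simp: S_def)
  ultimately show ?thesis
    using PQ by (intro that[OF M N PQ(1,2,3,5)]) (auto simp: S_def)
qed

lemma charts_at:
  assumes "x \<in> topspace X"
  obtains U \<phi> V \<psi> where "(U, \<phi>) \<in> \<Union>\<CC>" "(V, \<psi>) \<in> \<Union>\<DD>" "x \<in> U" "f x \<in> V"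
proof -
  have "f x \<in> topspace Y"
    using continuous assms by (auto simp: continuous_map_def)
  then show ?thesis
    using Cr_manifold_chart_at[OF X assms] Cr_manifold_chart_at[OF Y] that by metis
qed

lemma boundary_iff:
  assumes "x \<in> topspace X"
  shows "f x \<in> manifold_boundary TYPE('n) Y \<longleftrightarrow> x \<in> manifold_boundary TYPE('n) X"
proof -
  obtain U \<phi> V \<psi> where cd: "(U, \<phi>) \<in> \<Union>\<CC>" "(V, \<psi>) \<in> \<Union>\<DD>" "x \<in> U" "f x \<in> V"
    by (rule charts_at[OF assms])
  obtain M N P Q g h S where M: "model_chart M X U \<phi>" and N: "model_chart N Y V \<psi>"
    and PQ: "open P" "open Q" "homeomorphism P Q g h" and "\<And>k. enat k \<le> r \<Longrightarrow> Ck_on k h Q"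
    and S: "openin X S" "x \<in> S" "S \<subseteq> U" "f ` S \<subseteq> V" "\<phi> ` S \<subseteq> P"
    and rep: "\<And>u. u \<in> S \<Longrightarrow> g (\<phi> u) = \<psi> (f u)"
    by (rule representation_at[OF cd], rule that)
  have "\<psi> (f x) \<in> interior N" if "\<phi> x \<in> interior M"
    using regular_point_interior[OF M N S(1,3,4,5) PQ(3,2) rep S(2) that] .
  then show ?thesis
    using model_chart_boundary_iff[OF M cd(3)] model_chart_boundary_iff[OF N cd(4)]
      boundary_subset by blast
qed

lemma regular_nbhd:
  assumes "x \<in> topspace X"
  obtains S where "openin X S" "x \<in> S" "inj_on f S"
    "\<And>T. openin X T \<Longrightarrow> T \<subseteq> S \<Longrightarrow> openin Y (f ` T)"
proof -
  obtain U \<phi> V \<psi> where cd: "(U, \<phi>) \<in> \<Union>\<CC>" "(V, \<psi>) \<in> \<Union>\<DD>" "x \<in> U" "f x \<in> V"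
    by (rule charts_at[OF assms])
  obtain M N P Q g h S where M: "model_chart M X U \<phi>" and N: "model_chart N Y V \<psi>"
    and PQ: "open P" "open Q" "homeomorphism P Q g h" and "\<And>k. enat k \<le> r \<Longrightarrow> Ck_on k h Q"
    and S: "openin X S" "x \<in> S" "S \<subseteq> U" "f ` S \<subseteq> V" "\<phi> ` S \<subseteq> P"
    and rep: "\<And>u. u \<in> S \<Longrightarrow> g (\<phi> u) = \<psi> (f u)"
    by (rule representation_at[OF cd], rule that)
  have "inj_on f S"
  proof (rule inj_onI)
    fix u v assume uv: "u \<in> S" "v \<in> S" "f u = f v"
    then have "g (\<phi> u) = g (\<phi> v)"
      using rep by simp
    then have "\<phi> u = \<phi> v"
      using PQ(3) S(5) uv unfolding homeomorphism_def by (metis imageI subsetD)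
    then show "u = v"
      using model_chart_inj[OF M] S(3) uv by (meson inj_onD subsetD)
  qed
  moreover have "openin Y (f ` T)" if T: "openin X T" "T \<subseteq> S" for T
  proof (rule openin_image_of_regular_nbhd[OF M N T(1) _ _ _ PQ(3,1,2)])
    show "T \<subseteq> U" "f ` T \<subseteq> V" "\<phi> ` T \<subseteq> P" "\<And>u. u \<in> T \<Longrightarrow> g (\<phi> u) = \<psi> (f u)"
      using S(3) image_mono[OF T(2), of f] S(4) image_mono[OF T(2), of \<phi>] S(5) T(2) rep by blast+
    show "u \<in> manifold_boundary TYPE('n) X \<longleftrightarrow> f u \<in> manifold_boundary TYPE('n) Y" if "u \<in> T" for u
      using boundary_iff openin_subset[OF T(1)] that by blast
  qed
  ultimately show ?thesis
    using that S(1,2) by blast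
qed

lemma open_map: "open_map X Y f"
  unfolding open_map_def
proof (intro allI impI)
  fix U assume U: "openin X U"
  show "openin Y (f ` U)"
  proof (subst openin_subopen, intro ballI)
    fix y assume "y \<in> f ` U"
    then obtain x where x: "x \<in> U" "y = f x" by blast
    then have "x \<in> topspace X"
      using openin_subset[OF U] by blast
    then obtain S where S: "openin X S" "x \<in> S"
      "\<And>T. openin X T \<Longrightarrow> T \<subseteq> S \<Longrightarrow> openin Y (f ` T)"
      using regular_nbhd by metis
    have "openin Y (f ` (S \<inter> U))"
      using S(1,3) U by blast
    then show "\<exists>T. openin Y T \<and> y \<in> T \<and> T \<subseteq> f ` U"
      using x S(2) by blast
  qed
qed

lemma compact_local_homeomorphism:
  assumes "compact_space X"
  shows "compact_local_homeomorphism X Y f"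
proof
  show "Hausdorff_space X" "Hausdorff_space Y"
    using X Y by (auto simp: Cr_manifold_def topological_manifold_def)
  show "\<exists>U. openin X U \<and> x \<in> U \<and> inj_on f U" if "x \<in> topspace X" for x
    using regular_nbhd[OF that] by metis
qed (use assms continuous open_map in auto)

text \<open>Near a point of its domain, a local representative of the inverse coincides with the local inverse
\<open>h\<close> of a regular extension \<open>g\<close> of a local representative of \<open>f\<close>, and \<open>h\<close> is $C^r$.\<close>

lemma Cr_mapping_inverse:
  assumes bij: "bij_betw f (topspace X) (topspace Y)"
  shows "Cr_mapping r Y \<DD> X \<CC> (inv_into (topspace X) f)"
  unfolding Cr_mapping_def
proof (intro conjI ballI)
  let ?i = "inv_into (topspace X) f"
  have inj: "inj_on f (topspace X)" and surj: "f ` topspace X = topspace Y"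
    using bij by (auto simp: bij_betw_def)
  have "homeomorphic_map X Y f"
    using bijective_open_imp_homeomorphic_map[OF continuous open_map surj inj] .
  then obtain g where g: "homeomorphic_maps X Y f g"
    using homeomorphic_map_maps by blast
  have "g y = ?i y" if "y \<in> topspace Y" for y
  proof -
    have "g y \<in> topspace X" "f (g y) = y"
      using g that by (auto simp: homeomorphic_maps_def continuous_map_def)
    then show ?thesis
      using inv_into_f_f[OF inj] by metis
  qed
  then show "continuous_map Y X ?i"
    using g continuous_map_eq unfolding homeomorphic_maps_def by blast
  fix d c assume "d \<in> \<Union>\<DD>" "c \<in> \<Union>\<CC>"
  moreover obtain U \<phi> V \<psi> where eq: "c = (U, \<phi>)" "d = (V, \<psi>)"
    by (metis prod.collapse)
  ultimately have c: "(U, \<phi>) \<in> \<Union>\<CC>" and d: "(V, \<psi>) \<in> \<Union>\<DD>"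
    by auto
  have V: "V \<subseteq> topspace Y" "inj_on \<psi> V"
    using is_chart_imp_model_chart[OF Cr_manifold_is_chart[OF Y d]]
      model_chart_subset model_chart_inj by metis+
  let ?D = "local_domain d c ?i" and ?F = "local_map d c ?i"
  have D: "?D = \<psi> ` (V \<inter> ?i -` U)"
    by (simp add: eq local_domain_def)
  have F: "?F (\<psi> v) = \<phi> (?i v)" if "v \<in> V" for v
    using that V(2) by (simp add: eq local_map_def inv_into_f_f)
  show "Cr_on r ?F ?D"
    unfolding Cr_on_def
  proof
    fix q assume "q \<in> ?D"
    then obtain v where v: "v \<in> V" "?i v \<in> U" "q = \<psi> v"
      using D by blast
    define x where "x = ?i v"
    have x: "x \<in> U" "f x = v"
      using v V(1) surj by (auto simp: x_def f_inv_into_f)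
    then have fx: "f x \<in> V"
      using v by simp
    obtain M N P Q g h S where M: "model_chart M X U \<phi>" and N: "model_chart N Y V \<psi>"
      and PQ: "open P" "open Q" "homeomorphism P Q g h"
      and h: "\<And>k. enat k \<le> r \<Longrightarrow> Ck_on k h Q"
      and S: "openin X S" "x \<in> S" "S \<subseteq> U" "f ` S \<subseteq> V" "\<phi> ` S \<subseteq> P"
      and rep: "\<And>u. u \<in> S \<Longrightarrow> g (\<phi> u) = \<psi> (f u)"
      by (rule representation_at[OF c d x(1) fx], rule that)
    have SX: "S \<subseteq> topspace X"
      using openin_subset[OF S(1)] .
    \<comment> \<open>A neighbourhood of \<open>q\<close> is chosen such that the preimages stay in \<open>S\<close>, where \<open>g\<close> represents \<open>f\<close>.\<close>
    have "openin (top_of_set N) (\<psi> ` f ` S)"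
      using model_chart_openin_image[OF N] open_map S(1,4) by (simp add: open_map_def)
    then obtain T where T: "open T" "\<psi> ` f ` S = N \<inter> T"
      using openin_open by blast
    have hg: "h (g p) = p" if "p \<in> P" for p
      using PQ(3) that by (simp add: homeomorphism_def)
    have qS: "q \<in> \<psi> ` f ` S"
      using v(3) x(2) S(2) by blast
    have "\<phi> x \<in> P"
      using S(2,5) by blast
    then have "g (\<phi> x) \<in> Q"
      using PQ(3) unfolding homeomorphism_def by blast
    then have "q \<in> Q"
      using rep[OF S(2)] v(3) x(2) by simp
    moreover have "h y = ?F y" if y: "y \<in> ?D" "y \<in> Q \<inter> T" for y
    proof -
      obtain w where w: "w \<in> V" "y = \<psi> w"
        using y(1) D by blast
      then have "y \<in> \<psi> ` f ` S"
        using T(2) y(2) model_chart_image[OF N] by blast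
      then obtain s where s: "s \<in> S" "\<psi> w = \<psi> (f s)"
        using w(2) by (metis imageE)
      then have "w = f s"
        using V(2) w(1) S(4) by (metis image_subset_iff inj_onD)
      then have "?i w = s"
        using inv_into_f_f[OF inj, of s] s(1) SX by auto
      then have "?F y = \<phi> s"
        using F w by simp
      moreover have "y = g (\<phi> s)"
        using rep[OF s(1)] s(2) w(2) by simp
      ultimately show ?thesis
        using hg s(1) S(5) by auto
    qed
    ultimately show "\<exists>W g. open W \<and> q \<in> W \<and>
        (\<forall>k. enat k \<le> r \<longrightarrow> Ck_on k g W) \<and> (\<forall>y\<in>?D \<inter> W. g y = ?F y)"
      using PQ(2) T qS Ck_on_subset[OF h]
      by (intro exI[of _ "Q \<inter> T"] exI[of _ h]) auto
  qed
qed

end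

section \<open>The diffeomorphism theorem\<close>

theorem theorem2p7:
  fixes r :: enat
    and X :: "'a topology" and \<CC> :: "('a, 'n::{finite,wellorder}) chart set set"
    and Y :: "'b topology" and \<DD> :: "('b, 'n) chart set set"
    and f :: "'a \<Rightarrow> 'b"
  assumes "1 \<le> r"
    and "Cr_manifold r X \<CC>" and "connected_space X" and "compact_space X"
    and "Cr_manifold r Y \<DD>" and "connected_space Y"
    and "Cr_mapping r X \<CC> Y \<DD> f"
    and "nondegenerate_differential X \<CC> \<DD> f"
    and "f ` manifold_boundary TYPE('n) X \<subseteq> manifold_boundary TYPE('n) Y"
    and "manifold_boundary TYPE('n) X \<noteq> {}" and "manifold_boundary TYPE('n) Y \<noteq> {}"
    and "connected_components_of (subtopology X (manifold_boundary TYPE('n) X)) \<approx>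
         connected_components_of (subtopology Y (manifold_boundary TYPE('n) Y))"
    and "\<exists>C \<in> connected_components_of (subtopology Y (manifold_boundary TYPE('n) Y)).
           simply_connected_space (subtopology Y C)"
  shows "Cr_diffeomorphism r X \<CC> Y \<DD> f"
proof -
  let ?bX = "manifold_boundary TYPE('n) X" and ?bY = "manifold_boundary TYPE('n) Y"
  let ?A = "subtopology X ?bX" and ?B = "subtopology Y ?bY"
  interpret boundary_preserving_immersion r X \<CC> Y \<DD> f
    using assms by unfold_locales
  interpret F: compact_local_homeomorphism X Y f
    using compact_local_homeomorphism[OF assms(4)] .
  have bX: "?bX \<subseteq> topspace X" and bY: "?bY \<subseteq> topspace Y"
    by (auto simp: manifold_boundary_def)
  \<comment> \<open>So the restriction of \<open>f\<close> to the boundaries is again a local homeomorphism on a compact space.\<close>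
  have preimage: "{x \<in> topspace X. f x \<in> ?bY} = ?bX"
    using boundary_iff bX by blast
  interpret B: compact_local_homeomorphism ?A ?B f
    using F.restriction[OF closedin_manifold_boundary[where 'n='n and X=Y]] unfolding preimage .
  have surj: "f ` topspace X = topspace Y"
    using F.surj_if_connected[OF assms(6)] assms(10) bX by blast
  have surj_B: "f ` topspace ?A = topspace ?B"
  proof -
    have "?bY \<subseteq> f ` ?bX"
    proof
      fix y assume y: "y \<in> ?bY"
      then have "y \<in> f ` topspace X"
        using bY surj by blast
      then show "y \<in> f ` ?bX"
        using y preimage by blast
    qed
    then show ?thesis
      using assms(9) bX bY by (simp add: Int_absorb1)
  qed
  obtain C where C: "C \<in> connected_components_of ?B" "simply_connected_space (subtopology Y C)"
    using assms(13) by blast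
  have CB: "C \<subseteq> topspace ?B"
    using connected_components_of_subset[OF C(1)] .
  define D where "D = {x \<in> topspace ?A. f x \<in> C}"
  have nbhd: "\<exists>N. openin ?A N \<and> x \<in> N \<and> path_connectedin ?A N" if "x \<in> topspace ?A" for x
    using manifold_boundary_path_connected_nbhds[OF assms(2) that] .
  have "D \<in> connected_components_of ?A"
    unfolding D_def
    by (rule component_preimage_is_component[OF B.compact B.Hausdorff_C B.cont B.open_p surj_B nbhd
          assms(12) C(1)])
  then have "path_connectedin ?A D"
    using path_connectedin_component_if_path_connected_nbhds[OF nbhd] by blast
  then have "path_connected_space (subtopology ?A D)"
    by (simp add: path_connectedin_def)
  moreover have "subtopology ?B C = subtopology Y C"
    using CB by (simp add: subtopology_subtopology Int_absorb1)
  moreover have "compact_local_homeomorphism (subtopology ?A D) (subtopology ?B C) f"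
    using B.restriction[OF closedin_connected_components_of[OF C(1)]] unfolding D_def .
  ultimately have "inj_on f (topspace (subtopology ?A D))"
    using compact_local_homeomorphism.inj_on_if_simply_connected_base C(2) by metis
  then have injD: "inj_on f D"
    unfolding D_def by (rule inj_on_subset) auto
  obtain c where c: "c \<in> C"
    using nonempty_connected_components_of[OF C(1)] by blast
  then have cY: "c \<in> topspace Y" "c \<in> ?bY"
    using CB by auto
  \<comment> \<open>The fibre over \<open>c\<close> consists of boundary points, all of them in the single component \<open>D\<close>.\<close>
  have fibre: "x \<in> D" if "x \<in> topspace X" "f x = c" for x
    using that c cY(2) boundary_iff[OF that(1)] by (simp add: D_def)
  obtain x where x: "x \<in> topspace X" "f x = c"
    using cY(1) surj by (metis imageE)
  have "z = x" if "z \<in> topspace X" "f z = c" for z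
    using inj_onD[OF injD, of z x] fibre that x by simp
  then have "\<exists>!x. x \<in> topspace X \<and> f x = c"
    using x by blast
  then have "bij_betw f (topspace X) (topspace Y)"
    using F.bij_betw_if_unique_preimage[OF assms(6) cY(1)] by blast
  then show ?thesis
    unfolding Cr_diffeomorphism_def using assms(7) Cr_mapping_inverse by blast
qed

end
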